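(* Let $p>1$ and $w>0$ be real, with $w$ and $p$ not both even integers. Let $s_0=(w-1)/p$ and let $N$ be a positive integer with $N>s_0+\tfrac32$. Then $$\sum_{n=1}^\infty\frac{e^{-an^p}}{n^w}=J_p(a;w)+\sum_{k=0}^{N-1}{}^{'}\,\frac{(-1)^k}{k!}\,\zeta(w-kp)\,a^k+R_N,\qquad R_N=O(a^{N-\frac12})$$ as $a\to0$ in $|\arg a|<\tfrac12\pi$, where $$J_p(a;w)=\begin{cases}\dfrac1p\,\Gamma\Bigl(\dfrac{1-w}{p}\Bigr)a^{(w-1)/p}&\text{if } w\ne pM+1 \text{ for all integers } M\ge0,\\[2ex]\dfrac{(-a)^M}{M!}\Bigl\{\gamma-\dfrac1p\log a+\dfrac1p\,\psi(M+1)\Bigr\}&\text{if } w=pM+1 \text{ for an integer } M\ge0,\end{cases}$$ and the prime on the sum denotes the omission of the term $k=M$ when $w=pM+1$.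
   Context: $\zeta$ is the Riemann zeta function, $\gamma$ is Euler's constant, $\psi$ is the logarithmic derivative of the gamma function; powers and logarithms of $a$ are principal values. *)

theory Defs
  imports "HOL-Complex_Analysis.Complex_Analysis" "HOL-Library.Landau_Symbols"
begin

(* The analytic continuation of the Dirichlet series to the complex plane minus 1, which is
   unique by the identity theorem.  The value 0 at the pole 1 is a convention that makes the
   total function unique. *)
definition zeta :: "complex \<Rightarrow> complex" where
  "zeta = (THE f. f holomorphic_on (- {1}) \<and> f 1 = 0 \<and>
     (\<forall>s. Re s > 1 \<longrightarrow> (\<lambda>n. 1 / of_nat (Suc n) powr s) sums f s))"

(* For p > 0 there is at most one M with w = p * M + 1. *)
definition J_main :: "real \<Rightarrow> complex \<Rightarrow> real \<Rightarrow> complex" where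
  "J_main p a w =
     (if \<exists>M::nat. w = p * real M + 1
      then (let M = (THE M::nat. w = p * real M + 1) in
        (- a) ^ M / fact M *
          (euler_mascheroni - 1 / of_real p * Ln a + 1 / of_real p * Digamma (of_nat M + 1)))
      else 1 / of_real p * Gamma (of_real ((1 - w) / p)) * a powr of_real ((w - 1) / p))"

end

theory Submission imports Defs begin

text \<open>
  Write \<open>\<theta>\<^sub>v(a)\<close> for the sum of \<open>n\<^sup>-\<^sup>v exp(- a n\<^sup>p)\<close> over \<open>n \<ge> 1\<close> and \<open>J\<^sub>v\<close> for its singular part at \<open>a = 0\<close>.
  Differentiating in \<open>a\<close> lowers \<open>v\<close> by \<open>p\<close> and changes the sign, for the series termwise and for \<open>J\<^sub>v\<close> by
  the functional equations of the Gamma and Digamma functions, hence also for the difference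
  \<open>G\<^sub>v = \<theta>\<^sub>v - J\<^sub>v\<close> (\<open>gap_deriv\<close>).  So the Taylor coefficients of \<open>G\<^sub>w\<close> at the boundary point \<open>0\<close> of the
  half-plane are known once the boundary values of all \<open>G\<^sub>w\<^sub>-\<^sub>k\<^sub>p\<close> are, and a bound for \<open>G\<^sub>w\<^sub>-\<^sub>N\<^sub>p\<close> in a
  sector turns, after \<open>N\<close> integrations, into a remainder \<open>O(a\<^sup>N)\<close> there (\<open>cone_taylor\<close>), which is
  more than the asserted \<open>O(a\<^sup>N\<^sup>-\<^sup>1\<^sup>/\<^sup>2)\<close>.

  The boundary value of \<open>G\<^sub>v\<close> is \<open>\<zeta>(v)\<close> for every real \<open>v\<close> (\<open>gap_tendsto_zeta\<close>).  For \<open>v > 1\<close> this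
  is dominated convergence.  For \<open>v < 1\<close> the Euler-Maclaurin formula of high order is applied to
  \<open>x\<^sup>-\<^sup>v exp(- a x\<^sup>p)\<close>: its remainder converges absolutely, uniformly in \<open>a\<close> down to \<open>a = 0\<close>, and at \<open>a = 0\<close>
  the same expression is the analytic continuation of the zeta function, up to the pole
  \<open>1 / (v - 1)\<close>.  That pole is what the integral of \<open>x\<^sup>-\<^sup>v exp(- a x\<^sup>p)\<close> over \<open>[1, \<infinity>)\<close> leaves over
  after the Gamma integral over \<open>[0, \<infinity>)\<close>, which is \<open>J\<^sub>v\<close>, has been taken out.  For \<open>v = 1\<close> the
  integral is an exponential integral; it scales to the one for \<open>p = 1\<close>, where the series is
  \<open>- ln (1 - exp(- a))\<close>.  The convention \<open>\<zeta>(1) = 0\<close>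
  agrees with this: the boundary value at \<open>v = 1\<close> is \<open>0\<close>, so the omitted term may be kept.
  The same Euler-Maclaurin remainder also bounds \<open>G\<^sub>v\<close> in sectors for \<open>v < 0\<close> (\<open>gap_bounded\<close>).
\<close>

section \<open>Euler-Maclaurin summation on the unit interval\<close>

text \<open>
  Integrating \<open>g\<close> against a kernel and splitting off the mean of the kernel leaves a kernel whose
  primitive vanishes at both ends, so that integration by parts has no boundary terms.  Iterating
  this from \<open>t - 1\<close> yields, up to sign and additive constants, the Bernoulli polynomials divided by
  factorials.
\<close>

primrec em_kernel :: "nat \<Rightarrow> real \<Rightarrow> real" where
  "em_kernel 0 = (\<lambda>t. t - 1)"
| "em_kernel (Suc j) = (\<lambda>t. integral {0..t} (\<lambda>u. integral {0..1} (em_kernel j) - em_kernel j u))"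

abbreviation em_coeff :: "nat \<Rightarrow> real" where
  "em_coeff j \<equiv> integral {0..1} (em_kernel j)"

lemma continuous_em_kernel: "continuous_on {0..1} (em_kernel j)"
proof (induction j)
  case 0
  show ?case by (auto intro!: continuous_intros)
next
  case (Suc j)
  have "(\<lambda>u. em_coeff j - em_kernel j u) integrable_on {0..1}"
    by (intro integrable_continuous_real continuous_intros Suc)
  then show ?case
    by (simp add: indefinite_integral_continuous_1)
qed

lemma em_kernel_step:
  fixes g g' :: "real \<Rightarrow> complex"
  assumes der: "\<And>t. t \<in> {0..1} \<Longrightarrow> (g has_vector_derivative g' t) (at t within {0..1})"
    and cont: "continuous_on {0..1} g'"
  shows "integral {0..1} (\<lambda>t. em_kernel j t *\<^sub>R g t)
    = em_coeff j *\<^sub>R integral {0..1} g + integral {0..1} (\<lambda>t. em_kernel (Suc j) t *\<^sub>R g' t)"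
proof -
  let ?h = "\<lambda>u. em_coeff j - em_kernel j u"
  note [continuous_intros] = continuous_em_kernel
  have contg [continuous_intros]: "continuous_on {0..1} g"
    using der by (intro continuous_on_vector_derivative) blast
  have conth: "continuous_on {0..1} ?h"
    by (intro continuous_intros)
  have dK: "(em_kernel (Suc j) has_vector_derivative ?h t) (at t)" if "t \<in> {0<..<1}" for t
  proof -
    have "((\<lambda>t. integral {0..t} ?h) has_vector_derivative ?h t) (at t within {0..1})"
      using that by (intro integral_has_vector_derivative conth) auto
    then show ?thesis
      using that by (simp add: at_within_interior[of t "{0..1}"])
  qed
  have dg: "(g has_vector_derivative g' t) (at t)" if "t \<in> {0<..<1}" for t
    using der[of t] that by (simp add: at_within_interior[of t "{0..1}"])
  have K0: "em_kernel (Suc j) 0 = 0" by simp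
  have K1: "em_kernel (Suc j) 1 = 0"
    using has_integral_diff[OF has_integral_const_real[of "em_coeff j" 0 1]
        integrable_integral[OF integrable_continuous_real[OF continuous_em_kernel[of j]]]]
    by (simp add: integral_unique)
  have int: "(\<lambda>t. em_kernel (Suc j) t *\<^sub>R g' t) integrable_on {0..1}"
    by (intro integrable_continuous_real continuous_on_scaleR continuous_em_kernel cont)
  have "((\<lambda>t. ?h t *\<^sub>R g t) has_integral - integral {0..1} (\<lambda>t. em_kernel (Suc j) t *\<^sub>R g' t)) {0..1}"
    by (rule integration_by_parts_interior[OF bounded_bilinear_scaleR _ continuous_em_kernel[of "Suc j"] contg dK dg])
       (use K0 K1 int in \<open>simp_all only: scale_zero_left, auto simp del: em_kernel.simps intro: integrable_integral\<close>)
  then have "- integral {0..1} (\<lambda>t. em_kernel (Suc j) t *\<^sub>R g' t) = integral {0..1} (\<lambda>t. ?h t *\<^sub>R g t)"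
    by (simp add: integral_unique)
  also have "\<dots> = integral {0..1} (\<lambda>t. em_coeff j *\<^sub>R g t - em_kernel j t *\<^sub>R g t)"
    by (simp add: algebra_simps)
  also have "\<dots> = em_coeff j *\<^sub>R integral {0..1} g - integral {0..1} (\<lambda>t. em_kernel j t *\<^sub>R g t)"
    by (subst integral_diff) (auto intro!: integrable_continuous_real continuous_intros)
  finally show ?thesis by (simp add: algebra_simps)
qed

lemma em_local:
  fixes g :: "nat \<Rightarrow> real \<Rightarrow> complex"
  assumes der: "\<And>j t. t \<in> {0..1} \<Longrightarrow> (g j has_vector_derivative g (Suc j) t) (at t within {0..1})"
  shows "g 0 0 - integral {0..1} (g 0)
    = (\<Sum>j<r. em_coeff j *\<^sub>R (g j 1 - g j 0)) + integral {0..1} (\<lambda>t. em_kernel r t *\<^sub>R g (Suc r) t)"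
proof (induction r)
  case 0
  have contg: "continuous_on {0..1} (g j)" for j
    using der by (intro continuous_on_vector_derivative) blast
  have dg: "(g 0 has_vector_derivative g (Suc 0) t) (at t)" if "t \<in> {0<..<1}" for t
    using der[of t 0] that by (simp add: at_within_interior[of t "{0..1}"])
  have "((\<lambda>t. (1::real) *\<^sub>R g 0 t) has_integral
      (g 0 0 - integral {0..1} (\<lambda>t. (t - 1) *\<^sub>R g (Suc 0) t))) {0..1}"
    by (rule integration_by_parts_interior[OF bounded_bilinear_scaleR, where f = "\<lambda>t. t - 1" and g = "g 0" and g' = "g (Suc 0)"])
       (auto intro!: contg dg continuous_intros derivative_eq_intros integrable_integral integrable_continuous_real)
  then have "integral {0..1} (g 0) = g 0 0 - integral {0..1} (\<lambda>t. (t - 1) *\<^sub>R g (Suc 0) t)"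
    by (simp add: integral_unique)
  then show ?case by simp
next
  case (Suc r)
  have contg: "continuous_on {0..1} (g j)" for j
    using der by (intro continuous_on_vector_derivative) blast
  have "integral {0..1} (g (Suc r)) = g r 1 - g r 0"
    by (intro integral_unique fundamental_theorem_of_calculus der) auto
  then show ?case
    using em_kernel_step[of "g (Suc r)" "g (Suc (Suc r))" r, OF der contg] Suc by (simp del: em_kernel.simps)
qed

section \<open>The summand and its derivatives\<close>

text \<open>
  The \<open>j\<close>-th derivative of \<open>x\<^sup>-\<^sup>s exp(- a x\<^sup>p)\<close> in \<open>x\<close> is \<open>x\<^sup>-\<^sup>s\<^sup>-\<^sup>j q\<^sub>j(z) exp(- z)\<close> with
  \<open>z = a x\<^sup>p\<close>, where the polynomials \<open>q\<^sub>j\<close> obey the following recursion.  In this form the only effect of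
  \<open>a\<close> is through the factor \<open>q\<^sub>j(z) exp(- z)\<close>, which is bounded in sectors, and \<open>a = 0\<close> is an
  admissible value that produces the derivatives of \<open>x\<^sup>-\<^sup>s\<close>.
\<close>

primrec dpoly :: "real \<Rightarrow> complex \<Rightarrow> nat \<Rightarrow> complex poly" where
  "dpoly p s 0 = 1"
| "dpoly p s (Suc j) = smult (- (s + of_nat j)) (dpoly p s j)
     + smult (of_real p) (pCons 0 (pderiv (dpoly p s j) - dpoly p s j))"

definition damp :: "real \<Rightarrow> complex \<Rightarrow> complex \<Rightarrow> nat \<Rightarrow> real \<Rightarrow> complex" where
  "damp p s a j x = of_real x powr (- s - of_nat j) * poly (dpoly p s j) (a * of_real (x powr p))
     * exp (- a * of_real (x powr p))"

lemma has_vector_derivative_damp: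
  assumes "x > 0"
  shows "(damp p s a j has_vector_derivative damp p s a (Suc j) x) (at x within S)"
proof -
  define u where "u = (of_real x :: complex)"
  define z where "z = a * of_real (x powr p)"
  have x: "x powr p = x powr (p - 1) * x" using assms by (simp add: powr_diff)
  have up: "u powr (- s - of_nat j) = u powr (- s - of_nat (Suc j)) * u"
    using assms by (simp add: u_def powr_diff powr_add field_simps)
  have u0: "u \<noteq> 0" using assms by (simp add: u_def)
  have dpow: "((\<lambda>x. of_real x powr (- s - of_nat j)) has_vector_derivative
      (- s - of_nat j) * u powr (- s - of_nat (Suc j))) (at x within S)"
  proof -
    have "((\<lambda>z. z powr (- s - of_nat j)) has_field_derivative (- s - of_nat j) * u powr (- s - of_nat j - 1)) (at u)"
      using assms by (intro has_field_derivative_powr) (auto simp: u_def)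
    from field_vector_diff_chain_within[of of_real 1 x S, OF _ has_field_derivative_at_within[OF this[unfolded u_def]]]
    moreover have "(complex_of_real has_vector_derivative 1) (at x within S)"
      using has_vector_derivative_of_real[of "\<lambda>x. x" 1 "at x within S"] by simp
    ultimately show ?thesis by (simp add: o_def u_def algebra_simps)
  qed
  have dz: "((\<lambda>x. a * of_real (x powr p)) has_vector_derivative a * of_real (p * x powr (p - 1))) (at x within S)"
    using assms by (intro has_vector_derivative_mult_right has_vector_derivative_of_real)
      (auto intro!: derivative_eq_intros simp flip: has_real_derivative_iff_has_vector_derivative)
  have dq: "((\<lambda>z. poly (dpoly p s j) z * exp (- z)) has_field_derivative
      poly (pderiv (dpoly p s j) - dpoly p s j) z * exp (- z)) (at z within A)" for A
    by (auto intro!: derivative_eq_intros poly_DERIV[THEN DERIV_subset] simp: algebra_simps)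
  have d2: "((\<lambda>x. poly (dpoly p s j) (a * of_real (x powr p)) * exp (- a * of_real (x powr p))) has_vector_derivative
      a * of_real (p * x powr (p - 1)) * (poly (pderiv (dpoly p s j) - dpoly p s j) z * exp (- z))) (at x within S)"
    using field_vector_diff_chain_within[OF dz dq[unfolded z_def]] by (simp add: o_def z_def)
  have "(damp p s a j has_vector_derivative
      u powr (- s - of_nat j) * (a * of_real (p * x powr (p - 1)) * (poly (pderiv (dpoly p s j) - dpoly p s j) z * exp (- z)))
      + (- s - of_nat j) * u powr (- s - of_nat (Suc j)) * (poly (dpoly p s j) z * exp (- z))) (at x within S)"
    using has_vector_derivative_mult[OF dpow d2]
    by (simp add: damp_def[abs_def] u_def z_def mult.assoc)
  also have "u powr (- s - of_nat j) * (a * of_real (p * x powr (p - 1)) * (poly (pderiv (dpoly p s j) - dpoly p s j) z * exp (- z)))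
      = u powr (- s - of_nat (Suc j)) * (of_real p * z * (poly (pderiv (dpoly p s j) - dpoly p s j) z * exp (- z)))"
    unfolding up z_def x by (simp add: u_def algebra_simps)
  also have "\<dots> + (- s - of_nat j) * u powr (- s - of_nat (Suc j)) * (poly (dpoly p s j) z * exp (- z))
      = damp p s a (Suc j) x"
    by (simp add: damp_def u_def[symmetric] z_def[symmetric] algebra_simps)
  finally show ?thesis .
qed

lemma poly_exp_bounded:
  fixes q :: "complex poly"
  assumes "c > (0::real)"
  shows "\<exists>C\<ge>0. \<forall>z. norm (poly q z) \<le> C * exp (c * norm z)"
  using assms
proof (induction q arbitrary: c)
  case 0
  then show ?case by (auto intro!: exI[of _ 0])
next
  case (pCons b q)
  from pCons.IH[of "c / 2"] pCons.prems obtain C where C: "C \<ge> 0" "\<And>z. norm (poly q z) \<le> C * exp (c / 2 * norm z)"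
    by auto
  have "norm (poly (pCons b q) z) \<le> (norm b + 2 / c * C) * exp (c * norm z)" for z
  proof -
    have "c / 2 * norm z \<le> exp (c / 2 * norm z)"
      by (smt (verit) exp_ge_add_one_self)
    then have z: "norm z \<le> 2 / c * exp (c / 2 * norm z)"
      using pCons.prems by (simp add: field_simps)
    have "norm (poly (pCons b q) z) \<le> norm b + norm z * norm (poly q z)"
      by (metis norm_mult norm_triangle_ineq poly_pCons)
    also have "\<dots> \<le> norm b + (2 / c * exp (c / 2 * norm z)) * (C * exp (c / 2 * norm z))"
      using C z pCons.prems by (intro add_left_mono mult_mono) auto
    also have "(2 / c * exp (c / 2 * norm z)) * (C * exp (c / 2 * norm z)) = 2 / c * C * exp (c * norm z)"
      by (simp flip: exp_add)
    also have "norm b + \<dots> \<le> norm b * exp (c * norm z) + 2 / c * C * exp (c * norm z)"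
      using pCons.prems by (simp add: mult_le_cancel_left1)
    finally show ?thesis by (simp add: algebra_simps)
  qed
  then show ?case
    using C(1) pCons.prems by (intro exI[of _ "norm b + 2 / c * C"]) auto
qed

lemma norm_damp:
  assumes "x > 0"
  shows "norm (damp p s a j x) = x powr (- Re s - real j) * norm (poly (dpoly p s j) (a * of_real (x powr p)))
     * exp (- Re a * x powr p)"
  using assms by (simp add: damp_def norm_mult norm_powr_real_powr)

text \<open>
  The cone \<open>c * norm a \<le> Re a\<close> is a closed sector about the positive real axis, including \<open>0\<close>.  The
  constant does not depend on \<open>a\<close>, so every derivative in \<open>x\<close> gains a power of \<open>x\<close> uniformly
  in the sector: this makes high order Euler-Maclaurin remainders summable uniformly up to \<open>a = 0\<close>.
\<close>

lemma damp_cone_bound: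
  assumes "c > 0"
  shows "\<exists>C\<ge>0. \<forall>a x. c * norm a \<le> Re a \<longrightarrow> x > 0 \<longrightarrow>
           norm (damp p s a j x) \<le> C * x powr (- Re s - real j)"
proof -
  obtain C where C: "C \<ge> 0" "\<And>z. norm (poly (dpoly p s j) z) \<le> C * exp (c * norm z)"
    using poly_exp_bounded[OF assms] by blast
  have "norm (damp p s a j x) \<le> C * x powr (- Re s - real j)" if "c * norm a \<le> Re a" "x > 0" for a x
  proof -
    have "norm (poly (dpoly p s j) (a * of_real (x powr p))) \<le> C * exp (c * norm a * x powr p)"
      using C(2)[of "a * of_real (x powr p)"] by (simp add: norm_mult mult.assoc)
    also have "\<dots> \<le> C * exp (Re a * x powr p)"
      using that C by (intro mult_left_mono) (auto intro!: mult_right_mono)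
    finally have "norm (poly (dpoly p s j) (a * of_real (x powr p))) * exp (- Re a * x powr p) \<le> C"
      by (simp add: exp_minus field_simps)
    then have "x powr (- Re s - real j) * (norm (poly (dpoly p s j) (a * of_real (x powr p))) * exp (- Re a * x powr p))
        \<le> x powr (- Re s - real j) * C"
      by (intro mult_left_mono) auto
    then show ?thesis using that by (simp add: norm_damp mult_ac)
  qed
  then show ?thesis using C(1) by auto
qed

lemma powr_exp_decay:
  assumes "p > 0" "e > (0::real)"
  shows "\<exists>C\<ge>0. \<forall>x\<ge>1. x powr v * exp (- e * x powr p) \<le> C * x powr (-2)"
proof -
  obtain m :: nat where m: "real m \<ge> (v + 2) / p" using real_arch_simple by blast
  \<comment> \<open>\<open>u\<^sup>m \<le> C exp u\<close> for \<open>u = e x\<^sup>p\<close> trades the exponential for the power \<open>x\<^sup>-\<^sup>p\<^sup>m\<close>\<close>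
  obtain C where C: "C \<ge> 0" "\<And>z::complex. norm (poly (monom 1 m) z) \<le> C * exp (1 * norm z)"
    using poly_exp_bounded[of 1 "monom 1 m"] by auto
  have "x powr v * exp (- e * x powr p) \<le> C / e ^ m * x powr (-2)" if "x \<ge> 1" for x
  proof -
    have "v + 2 \<le> p * real m" using m assms by (simp add: field_simps)
    then have "x powr (v + 2) \<le> x powr (p * real m)" using that by (intro powr_mono) auto
    also have "x powr (p * real m) = (x powr p) ^ m"
      using that by (simp add: powr_powr flip: powr_realpow)
    also have "\<dots> = (e * x powr p) ^ m / e ^ m"
      using assms by (simp add: power_mult_distrib)
    also have "\<dots> \<le> C * exp (e * x powr p) / e ^ m"
      using C(2)[of "of_real (e * x powr p)"] assms
      by (intro divide_right_mono) (auto simp: poly_monom norm_power norm_mult)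
    finally have "x powr v * x powr 2 \<le> C * exp (e * x powr p) / e ^ m"
      by (simp add: powr_add)
    then have "x powr v * x powr 2 / x powr 2 / exp (e * x powr p) \<le> C * exp (e * x powr p) / e ^ m / x powr 2 / exp (e * x powr p)"
      by (intro divide_right_mono) auto
    then show ?thesis using that by (simp add: exp_minus powr_minus divide_inverse mult_ac)
  qed
  then show ?thesis using assms C(1) by (intro exI[of _ "C / e ^ m"]) auto
qed

lemma damp0_decay:
  assumes "p > 0" "e > 0"
  shows "\<exists>C\<ge>0. \<forall>a x. Re a \<ge> e \<longrightarrow> x \<ge> 1 \<longrightarrow> norm (damp p s a 0 x) \<le> C * x powr (-2)"
proof -
  obtain C where C: "C \<ge> 0" "\<And>x. x \<ge> 1 \<Longrightarrow> x powr (- Re s) * exp (- e * x powr p) \<le> C * x powr (-2)"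
    using powr_exp_decay[OF assms] by blast
  have "norm (damp p s a 0 x) \<le> C * x powr (-2)" if "Re a \<ge> e" "x \<ge> 1" for a x
  proof -
    have "norm (damp p s a 0 x) = x powr (- Re s) * exp (- Re a * x powr p)"
      using that by (simp add: norm_damp)
    also have "\<dots> \<le> x powr (- Re s) * exp (- e * x powr p)"
      using that by (intro mult_left_mono) (auto intro!: mult_right_mono)
    finally show ?thesis using C(2)[of x] that by linarith
  qed
  then show ?thesis using C(1) by auto
qed

lemma damp_decay:
  assumes "p > 0" "Re a > 0"
  shows "\<exists>C\<ge>0. \<forall>x\<ge>1. norm (damp p s a j x) \<le> C * x powr (-2)"
proof -
  \<comment> \<open>half of the exponential decay absorbs the polynomial factor\<close>
  define c where "c = Re a / (2 * norm a)"
  have a: "norm a > 0" using assms by auto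
  have c: "c > 0" using a assms by (simp add: c_def)
  obtain C where C: "C \<ge> 0" "\<And>z. norm (poly (dpoly p s j) z) \<le> C * exp (c * norm z)"
    using poly_exp_bounded[OF c] by blast
  obtain D where D: "D \<ge> 0" "\<And>x. x \<ge> 1 \<Longrightarrow> x powr (- Re s - real j) * exp (- (Re a / 2) * x powr p) \<le> D * x powr (-2)"
    using powr_exp_decay[of p "Re a / 2"] assms by (metis half_gt_zero)
  have "norm (damp p s a j x) \<le> C * D * x powr (-2)" if "x \<ge> 1" for x
  proof -
    have "norm (poly (dpoly p s j) (a * of_real (x powr p))) \<le> C * exp (Re a / 2 * x powr p)"
      using C(2)[of "a * of_real (x powr p)"] a by (simp add: norm_mult c_def)
    then have "norm (poly (dpoly p s j) (a * of_real (x powr p))) * exp (- Re a * x powr p)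
        \<le> C * exp (Re a / 2 * x powr p) * exp (- Re a * x powr p)"
      by (intro mult_right_mono) auto
    also have "\<dots> = C * exp (- (Re a / 2) * x powr p)" by (simp flip: exp_add)
    finally have "x powr (- Re s - real j) * (norm (poly (dpoly p s j) (a * of_real (x powr p))) * exp (- Re a * x powr p))
      \<le> x powr (- Re s - real j) * (C * exp (- (Re a / 2) * x powr p))"
      by (intro mult_left_mono) auto
    also have "\<dots> \<le> C * (D * x powr (-2))"
      using mult_left_mono[OF D(2)[OF that] C(1)] by (simp add: mult_ac)
    finally show ?thesis using that by (simp add: norm_damp mult_ac)
  qed
  then show ?thesis using C D by (intro exI[of _ "C * D"]) auto
qed

section \<open>Euler-Maclaurin summation of the series\<close>

abbreviation damp_int :: "real \<Rightarrow> complex \<Rightarrow> complex \<Rightarrow> nat \<Rightarrow> complex" where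
  "damp_int p s a n \<equiv> integral {0..1} (\<lambda>t. damp p s a 0 (real (Suc n) + t))"

definition em_rem :: "nat \<Rightarrow> real \<Rightarrow> complex \<Rightarrow> complex \<Rightarrow> nat \<Rightarrow> complex" where
  "em_rem r p s a n = integral {0..1} (\<lambda>t. em_kernel r t *\<^sub>R damp p s a (Suc r) (real (Suc n) + t))"

lemma continuous_on_damp: "(\<And>x. x \<in> S \<Longrightarrow> x > 0) \<Longrightarrow> continuous_on S (damp p s a j)"
  by (rule continuous_on_vector_derivative) (rule has_vector_derivative_damp, simp)

lemma continuous_on_damp_shift: "continuous_on {0..1} (\<lambda>t. damp p s a j (real (Suc n) + t))"
  by (rule continuous_on_compose2[OF continuous_on_damp[of "{0<..}"]]) (auto intro!: continuous_intros)

lemma em_damp: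
  "damp p s a 0 (real (Suc n)) - damp_int p s a n =
     (\<Sum>j<r. em_coeff j *\<^sub>R (damp p s a j (real (Suc (Suc n))) - damp p s a j (real (Suc n)))) + em_rem r p s a n"
proof -
  have "((\<lambda>t. damp p s a j (real (Suc n) + t)) has_vector_derivative damp p s a (Suc j) (real (Suc n) + t)) (at t within {0..1})"
    if "t \<in> {0..1}" for t j
  proof -
    have "((\<lambda>t. real (Suc n) + t) has_vector_derivative 1) (at t within {0..1})"
      by (auto intro!: derivative_eq_intros)
    from vector_diff_chain_within[OF this has_vector_derivative_damp] that show ?thesis
      by (simp add: o_def)
  qed
  from em_local[of "\<lambda>j t. damp p s a j (real (Suc n) + t)", OF this, of r] show ?thesis
    by (simp add: em_rem_def add_ac)
qed

lemma em_rem_bound: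
  "\<exists>B\<ge>0. \<forall>p s a n C v. C \<ge> 0 \<longrightarrow> v \<ge> 0 \<longrightarrow> (\<forall>x\<ge>1. norm (damp p s a (Suc r) x) \<le> C * x powr (- v)) \<longrightarrow>
     norm (em_rem r p s a n) \<le> B * C * real (Suc n) powr (- v)"
proof -
  have "bounded (em_kernel r ` {0..1})"
    by (intro compact_imp_bounded compact_continuous_image continuous_em_kernel) auto
  then obtain B where B: "B > 0" "\<And>t. t \<in> {0..1} \<Longrightarrow> \<bar>em_kernel r t\<bar> \<le> B"
    by (auto simp: bounded_pos)
  have "norm (em_rem r p s a n) \<le> B * C * real (Suc n) powr (- v)"
    if C: "C \<ge> 0" and v: "v \<ge> 0" and bd: "\<And>x. x \<ge> 1 \<Longrightarrow> norm (damp p s a (Suc r) x) \<le> C * x powr (- v)"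
    for p s a n C v
  proof -
    have "norm (em_kernel r t *\<^sub>R damp p s a (Suc r) (real (Suc n) + t)) \<le> B * C * real (Suc n) powr (- v)"
      if t: "t \<in> {0..1}" for t
    proof -
      have "norm (damp p s a (Suc r) (real (Suc n) + t)) \<le> C * (real (Suc n) + t) powr (- v)"
        using t by (intro bd) auto
      also have "\<dots> \<le> C * real (Suc n) powr (- v)"
        using t v C by (intro mult_left_mono powr_mono2') auto
      finally show ?thesis
        using B t by (auto simp: mult.assoc intro!: mult_mono)
    qed
    then have "norm (em_rem r p s a n) \<le> B * C * real (Suc n) powr (- v) * (1 - 0)"
      unfolding em_rem_def
      by (intro integral_bound continuous_intros continuous_on_scaleR continuous_em_kernel continuous_on_damp_shift) auto
    then show ?thesis by simp
  qed
  then show ?thesis using B(1) by (intro exI[of _ B]) auto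
qed

lemma summable_Suc_powr: "v > 1 \<Longrightarrow> summable (\<lambda>n. real (Suc n) powr (- v))"
  by (subst summable_Suc_iff) (simp add: summable_real_powr_iff)

text \<open>
  The value of the sum over \<open>n \<ge> 1\<close> minus the integral over \<open>[1, \<infinity>)\<close>, in a form that still makes sense
  when the sum and the integral diverge separately; \<open>r\<close> is the order of the summation formula.
\<close>

definition em_regular :: "nat \<Rightarrow> real \<Rightarrow> complex \<Rightarrow> complex \<Rightarrow> complex" where
  "em_regular r p s a = (\<Sum>n. em_rem r p s a n) - (\<Sum>j<r. em_coeff j *\<^sub>R damp p s a j 1)"

lemma em_sums:
  assumes lim: "\<And>j. j < r \<Longrightarrow> (\<lambda>n. damp p s a j (real (Suc n))) \<longlonglongrightarrow> 0"
    and "summable (em_rem r p s a)"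
  shows "(\<lambda>n. damp p s a 0 (real (Suc n)) - damp_int p s a n) sums em_regular r p s a"
proof -
  have "(\<lambda>n. (\<Sum>j<r. em_coeff j *\<^sub>R (damp p s a j (real (Suc (Suc n))) - damp p s a j (real (Suc n)))) + em_rem r p s a n)
     sums ((\<Sum>j<r. em_coeff j *\<^sub>R (0 - damp p s a j (real (Suc 0)))) + (\<Sum>n. em_rem r p s a n))"
    by (intro sums_add sums_sum sums_scaleR_right telescope_sums lim summable_sums assms) auto
  then show ?thesis
    unfolding em_damp[of p s a _ r] by (simp add: em_regular_def sum_negf)
qed

section \<open>Analytic continuation of the zeta function\<close>

lemma holomorphic_poly_dpoly_0: "(\<lambda>s. poly (dpoly p s j) 0) holomorphic_on A"
  by (induction j) (auto intro!: holomorphic_intros)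

lemma holomorphic_damp_0: "x > 0 \<Longrightarrow> (\<lambda>s. damp p s 0 j x) holomorphic_on A"
  by (auto simp: damp_def intro!: holomorphic_intros holomorphic_poly_dpoly_0)

lemma damp_int_0:
  assumes "s \<noteq> 1"
  shows "damp_int p s 0 n = (of_nat (Suc (Suc n)) powr (1 - s) - of_nat (Suc n) powr (1 - s)) / (1 - s)"
proof -
  let ?F = "\<lambda>t. complex_of_real (real (Suc n) + t) powr (1 - s) / (1 - s)"
  have "(?F has_vector_derivative damp p s 0 0 (real (Suc n) + t)) (at t within {0..1})" if "t \<in> {0..1}" for t
  proof -
    have pos: "real (Suc n) + t > 0" using that by auto
    have d1: "((\<lambda>t. complex_of_real (real (Suc n) + t)) has_vector_derivative of_real 1) (at t within {0..1})"
      by (intro has_vector_derivative_of_real) (auto intro!: derivative_eq_intros)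
    have d2: "((\<lambda>z. z powr (1 - s) / (1 - s)) has_field_derivative (1 - s) * of_real (real (Suc n) + t) powr (1 - s - 1) / (1 - s))
       (at (complex_of_real (real (Suc n) + t)))"
      by (intro DERIV_cdivide has_field_derivative_powr) (use pos in \<open>simp add: complex_nonpos_Reals_iff\<close>)
    show ?thesis
      using field_vector_diff_chain_within[OF d1 has_field_derivative_at_within[OF d2]] assms
      by (simp add: o_def damp_def)
  qed
  from fundamental_theorem_of_calculus[OF _ this]
  have "((\<lambda>t. damp p s 0 0 (real (Suc n) + t)) has_integral (?F 1 - ?F 0)) {0..1}"
    by simp
  then show ?thesis by (simp add: integral_unique diff_divide_distrib add_ac)
qed

lemma norm_damp_0: "x > 0 \<Longrightarrow> norm (damp p s 0 j x) = norm (poly (dpoly p s j) 0) * x powr (- Re s - real j)"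
  by (simp add: norm_damp)

lemma summable_em_rem_0:
  assumes "Re s > - real r"
  shows "summable (em_rem r p s 0)"
proof -
  obtain B where B: "B \<ge> 0" "\<And>p s a n C v. C \<ge> 0 \<Longrightarrow> v \<ge> 0 \<Longrightarrow> (\<And>x. x \<ge> 1 \<Longrightarrow> norm (damp p s a (Suc r) x) \<le> C * x powr (- v)) \<Longrightarrow>
     norm (em_rem r p s a n) \<le> B * C * real (Suc n) powr (- v)"
    using em_rem_bound[of r] by blast
  have "norm (em_rem r p s 0 n) \<le> B * norm (poly (dpoly p s (Suc r)) 0) * real (Suc n) powr (- (Re s + real (Suc r)))" for n
    using assms by (intro B(2)) (auto simp: norm_damp_0 simp del: dpoly.simps intro!: mult_left_mono powr_mono)
  moreover have "summable (\<lambda>n. B * norm (poly (dpoly p s (Suc r)) 0) * real (Suc n) powr (- (Re s + real (Suc r))))"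
    using assms by (intro summable_mult summable_Suc_powr) auto
  ultimately show ?thesis
    by (rule summable_comparison_test'[rotated, where N = 0])
qed

text \<open>
  At \<open>a = 0\<close> the regular part is the zeta function minus its pole, wherever the remainder series
  converges, that is for \<open>Re s > - r\<close>.  The exponent \<open>p\<close> does not affect the value
  (\<open>zeta_em_indep\<close>); it is kept so that the formula matches the regular part for \<open>a \<noteq> 0\<close>.
\<close>

definition zeta_em :: "nat \<Rightarrow> real \<Rightarrow> complex \<Rightarrow> complex" where
  "zeta_em r p s = 1 / (s - 1) + em_regular r p s 0"

lemma holomorphic_zeta_em: "zeta_em r p holomorphic_on ({s. Re s > - real r} - {1})"
proof -
  let ?S = "{s. Re s > - real r} - {1}"
  have opn: "open ?S" by (intro open_Diff open_halfspace_Re_gt) auto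
  obtain B where B: "B \<ge> 0" "\<And>p s a n C v. C \<ge> 0 \<Longrightarrow> v \<ge> 0 \<Longrightarrow> (\<And>x. x \<ge> 1 \<Longrightarrow> norm (damp p s a (Suc r) x) \<le> C * x powr (- v)) \<Longrightarrow>
     norm (em_rem r p s a n) \<le> B * C * real (Suc n) powr (- v)"
    using em_rem_bound[of r] by blast
  have hol1: "(\<lambda>s. em_rem r p s 0 n) holomorphic_on ?S" for n
  proof -
    have "(\<lambda>s. damp p s 0 0 (real (Suc n)) - (of_nat (Suc (Suc n)) powr (1 - s) - of_nat (Suc n) powr (1 - s)) / (1 - s)
       - (\<Sum>j<r. em_coeff j *\<^sub>R (damp p s 0 j (real (Suc (Suc n))) - damp p s 0 j (real (Suc n))))) holomorphic_on ?S"
      unfolding scaleR_conv_of_real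
      by (intro holomorphic_intros holomorphic_damp_0) (auto simp del: of_nat_Suc)
    then show ?thesis
    proof (rule holomorphic_transform)
      fix s assume "s \<in> ?S"
      then show "damp p s 0 0 (real (Suc n)) - (of_nat (Suc (Suc n)) powr (1 - s) - of_nat (Suc n) powr (1 - s)) / (1 - s)
         - (\<Sum>j<r. em_coeff j *\<^sub>R (damp p s 0 j (real (Suc (Suc n))) - damp p s 0 j (real (Suc n)))) = em_rem r p s 0 n"
        using em_damp[of p s 0 n r] damp_int_0[of s p n] by (simp add: algebra_simps)
    qed
  qed
  have "(\<lambda>s. \<Sum>n. em_rem r p s 0 n) holomorphic_on ?S"
  proof (rule holomorphic_uniform_sequence[OF opn])
    show "(\<lambda>s. \<Sum>i<n. em_rem r p s 0 i) holomorphic_on ?S" for n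
      by (intro holomorphic_intros hol1)
  next
    fix s assume "s \<in> ?S"
    then obtain d where d: "d > 0" "cball s d \<subseteq> ?S"
      using opn open_contains_cball by blast
    define e where "e = min d ((Re s + real r) / 2)"
    have e: "e > 0" "e \<le> d"
      using d \<open>s \<in> ?S\<close> by (auto simp: e_def)
    have e3: "e \<le> (Re s + real r) / 2"
      by (simp only: e_def min.cobounded2)
    define \<sigma> where "\<sigma> = (Re s - real r) / 2"
    have \<sigma>: "\<sigma> > - real r" using \<open>s \<in> ?S\<close> by (auto simp: \<sigma>_def field_simps)
    have Re: "Re z \<ge> \<sigma>" if "z \<in> cball s e" for z
      using abs_Re_le_cmod[of "s - z"] that e3 by (auto simp: \<sigma>_def dist_norm field_simps)
    have "bounded ((\<lambda>z. poly (dpoly p z (Suc r)) 0) ` cball s e)"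
      by (intro compact_imp_bounded compact_continuous_image
          holomorphic_on_imp_continuous_on[OF holomorphic_poly_dpoly_0]) auto
    then obtain M where M: "M > 0" "\<And>z. z \<in> cball s e \<Longrightarrow> norm (poly (dpoly p z (Suc r)) 0) \<le> M"
      by (auto simp: bounded_pos simp del: dpoly.simps)
    have "norm (em_rem r p z 0 n) \<le> B * M * real (Suc n) powr (- (\<sigma> + real (Suc r)))" if z: "z \<in> cball s e" for n z
    proof (rule B(2))
      fix x :: real assume "x \<ge> 1"
      then have "norm (damp p z 0 (Suc r) x) = norm (poly (dpoly p z (Suc r)) 0) * x powr (- Re z - real (Suc r))"
        by (subst norm_damp_0) auto
      also have "\<dots> \<le> M * x powr (- (\<sigma> + real (Suc r)))"
        using M z Re[OF z] \<open>x \<ge> 1\<close> by (intro mult_mono powr_mono) (auto simp del: dpoly.simps)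
      finally show "norm (damp p z 0 (Suc r) x) \<le> M * x powr (- (\<sigma> + real (Suc r)))" .
    qed (use M \<sigma> in auto)
    moreover have "summable (\<lambda>n. B * M * real (Suc n) powr (- (\<sigma> + real (Suc r))))"
      using \<sigma> by (intro summable_mult summable_Suc_powr) auto
    ultimately have "uniform_limit (cball s e) (\<lambda>n z. \<Sum>i<n. em_rem r p z 0 i) (\<lambda>z. \<Sum>n. em_rem r p z 0 n) sequentially"
      by (intro Weierstrass_m_test)
    moreover have "cball s e \<subseteq> ?S" using d e by (meson order_trans subset_cball)
    ultimately show "\<exists>d>0. cball s d \<subseteq> ?S \<and> uniform_limit (cball s d) (\<lambda>n z. \<Sum>i<n. em_rem r p z 0 i) (\<lambda>z. \<Sum>n. em_rem r p z 0 n) sequentially"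
      using e by blast
  qed
  then show ?thesis
    unfolding zeta_em_def[abs_def] em_regular_def scaleR_conv_of_real
    by (intro holomorphic_intros holomorphic_damp_0) auto
qed

lemma powr_Suc_tendsto_0: "v < 0 \<Longrightarrow> (\<lambda>n. real (Suc n) powr v) \<longlonglongrightarrow> 0"
  by real_asymp

lemma zeta_em_dirichlet:
  assumes "Re s > 1"
  shows "(\<lambda>n. 1 / of_nat (Suc n) powr s) sums zeta_em r p s"
proof -
  have s: "s \<noteq> 1" using assms by auto
  have lim: "(\<lambda>n. damp p s 0 j (real (Suc n))) \<longlonglongrightarrow> 0" for j
  proof (rule Lim_null_comparison)
    show "\<forall>\<^sub>F n in sequentially. norm (damp p s 0 j (real (Suc n))) \<le> norm (poly (dpoly p s j) 0) * real (Suc n) powr (- Re s - real j)"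
      by (intro always_eventually allI eq_refl norm_damp_0) auto
    show "(\<lambda>n. norm (poly (dpoly p s j) 0) * real (Suc n) powr (- Re s - real j)) \<longlonglongrightarrow> 0"
      using assms by (intro tendsto_mult_right_zero powr_Suc_tendsto_0) auto
  qed
  have "(\<lambda>n. of_nat (Suc n) powr (1 - s)) \<longlonglongrightarrow> (0::complex)"
  proof (rule Lim_null_comparison)
    show "\<forall>\<^sub>F n in sequentially. norm (of_nat (Suc n) powr (1 - s) :: complex) \<le> real (Suc n) powr (1 - Re s)"
      by (intro always_eventually allI) (subst norm_powr_real_powr, auto simp del: of_nat_Suc)
    show "(\<lambda>n. real (Suc n) powr (1 - Re s)) \<longlonglongrightarrow> 0"
      using assms by (intro powr_Suc_tendsto_0) auto
  qed
  from sums_divide[OF telescope_sums[OF this], of "1 - s"] have "damp_int p s 0 sums ((0 - of_nat (Suc 0) powr (1 - s)) / (1 - s))"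
    by (simp only: damp_int_0[OF s, of p])
  also have "(0 - of_nat (Suc 0) powr (1 - s)) / (1 - s) = 1 / (s - 1)"
    using s by (simp add: field_simps)
  finally have int: "damp_int p s 0 sums (1 / (s - 1))" .
  have "(\<lambda>n. damp p s 0 0 (real (Suc n)) - damp_int p s 0 n) sums em_regular r p s 0"
    by (rule em_sums[OF lim summable_em_rem_0]) (use assms in auto)
  from sums_add[OF this int] have "(\<lambda>n. damp p s 0 0 (real (Suc n))) sums zeta_em r p s"
    by (simp add: zeta_em_def algebra_simps)
  also have "(\<lambda>n. damp p s 0 0 (real (Suc n))) = (\<lambda>n. 1 / of_nat (Suc n) powr s)"
    by (simp add: damp_def powr_minus field_simps fun_eq_iff)
  finally show ?thesis .
qed

text \<open>
  Different orders and exponents give the same Dirichlet series for \<open>Re s > 1\<close>, so the identity theorem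
  glues the half-planes together.
\<close>

lemma zeta_em_indep:
  assumes "s \<noteq> 1" "Re s > - real r" "Re s > - real r'"
  shows "zeta_em r p s = zeta_em r' p' s"
proof (rule analytic_continuation_open[of "{s. Re s > 1}" "{s. Re s > - real (min r r')} - {1}" "zeta_em r p" "zeta_em r' p'"])
  show "open {s. Re s > 1}" "open ({s. Re s > - real (min r r')} - {1})"
    by (auto intro!: open_Diff open_halfspace_Re_gt)
  have "complex_of_real 2 \<in> {s. Re s > 1}" by simp
  then show "{s. Re s > 1} \<noteq> {}" by blast
  show "connected ({s. Re s > - real (min r r')} - {1})"
    by (intro connected_open_delete convex_connected convex_halfspace_Re_gt open_halfspace_Re_gt) simp
  show "{s. 1 < Re s} \<subseteq> {s. - real (min r r') < Re s} - {1}" by auto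
  show "zeta_em r p holomorphic_on {s. Re s > - real (min r r')} - {1}"
    by (rule holomorphic_on_subset[OF holomorphic_zeta_em]) auto
  show "zeta_em r' p' holomorphic_on {s. Re s > - real (min r r')} - {1}"
    by (rule holomorphic_on_subset[OF holomorphic_zeta_em]) auto
  show "zeta_em r p z = zeta_em r' p' z" if "z \<in> {s. Re s > 1}" for z
    using zeta_em_dirichlet[of z r p] zeta_em_dirichlet[of z r' p'] that sums_unique2 by blast
  show "s \<in> {s. - real (min r r') < Re s} - {1}" using assms by auto
qed

lemma zeta_unique:
  assumes "f holomorphic_on (- {1})" "g holomorphic_on (- {1})" "f 1 = g 1"
    and "\<And>s. Re s > 1 \<Longrightarrow> f s = g s"
  shows "f = (g :: complex \<Rightarrow> complex)"
proof
  fix s :: complex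
  have "complex_of_real 2 \<in> {s. Re s > 1}" by simp
  then have ne: "{s. Re s > 1} \<noteq> {}" by blast
  have "f s = g s" if "s \<noteq> 1"
    by (rule analytic_continuation_open[of "{s. Re s > 1}" "- {1}"])
       (use assms ne that in \<open>auto intro!: open_halfspace_Re_gt connected_punctured_universe\<close>)
  then show "f s = g s" using assms(3) by (cases "s = 1") auto
qed

lemma zeta_1: "zeta 1 = 0"
  and zeta_eq_zeta_em: "s \<noteq> 1 \<Longrightarrow> Re s > - real r \<Longrightarrow> zeta s = zeta_em r p s"
proof -
  define Z where "Z = (\<lambda>s. if s = 1 then 0 else zeta_em (nat \<lceil>- Re s\<rceil> + 1) 1 s)"
  have Z: "Z s = zeta_em r p s" if "s \<noteq> 1" "Re s > - real r" for s r p
  proof -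
    have "Re s > - real (nat \<lceil>- Re s\<rceil> + 1)" by linarith
    then show ?thesis using that zeta_em_indep unfolding Z_def by presburger
  qed
  have "(- {1} :: complex set) = (\<Union>r. {s. Re s > - real r} - {1})"
  proof (intro equalityI subsetI)
    fix s :: complex assume "s \<in> - {1}"
    moreover obtain r :: nat where "- Re s < real r" using reals_Archimedean2 by blast
    ultimately show "s \<in> (\<Union>r. {s. Re s > - real r} - {1})" by (auto intro!: exI[of _ r])
  qed auto
  moreover have "Z holomorphic_on (\<Union>r. {s. Re s > - real r} - {1})"
  proof (rule holomorphic_on_UN_open)
    show "Z holomorphic_on ({s. Re s > - real r} - {1})" for r
      using Z by (intro holomorphic_transform[OF holomorphic_zeta_em[of r 1]]) auto
  qed (auto intro!: open_Diff open_halfspace_Re_gt)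
  ultimately have hol: "Z holomorphic_on (- {1})" by simp
  have dir: "(\<lambda>n. 1 / of_nat (Suc n) powr s) sums Z s" if "Re s > 1" for s
  proof -
    have "s \<noteq> 1" using that by auto
    then have "Z s = zeta_em 0 1 s" using that by (intro Z) auto
    then show ?thesis using zeta_em_dirichlet[OF that, of 0 1] by simp
  qed
  have "zeta = Z"
    unfolding zeta_def
  proof (rule the_equality)
    show "Z holomorphic_on - {1} \<and> Z 1 = 0 \<and> (\<forall>s. 1 < Re s \<longrightarrow> (\<lambda>n. 1 / of_nat (Suc n) powr s) sums Z s)"
      using hol dir by (auto simp: Z_def)
    fix f assume f: "f holomorphic_on - {1} \<and> f 1 = 0 \<and> (\<forall>s. 1 < Re s \<longrightarrow> (\<lambda>n. 1 / of_nat (Suc n) powr s) sums f s)"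
    show "f = Z"
    proof (rule zeta_unique)
      show "f s = Z s" if "Re s > 1" for s
        using f dir[OF that] that sums_unique2 by blast
    qed (use f hol in \<open>auto simp: Z_def\<close>)
  qed
  moreover have "Z 1 = 0" by (simp add: Z_def)
  ultimately show "zeta 1 = 0" "s \<noteq> 1 \<Longrightarrow> Re s > - real r \<Longrightarrow> zeta s = zeta_em r p s"
    using Z[of s r p] by auto
qed

section \<open>The series as a function of a\<close>

definition theta :: "real \<Rightarrow> real \<Rightarrow> complex \<Rightarrow> complex" where
  "theta p v a = (\<Sum>n. damp p (of_real v) a 0 (real (Suc n)))"

lemma damp0_eq:
  "x \<ge> 0 \<Longrightarrow> damp p (of_real v) a 0 x = of_real (x powr (- v)) * exp (- a * of_real (x powr p))"
  by (cases "x = 0") (simp_all add: damp_def powr_of_real[symmetric])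

lemma damp0_deriv:
  assumes "x > 0"
  shows "((\<lambda>a. damp p (of_real v) a 0 x) has_field_derivative - damp p (of_real (v - p)) a 0 x) (at a within S)"
proof -
  have "x powr (- (v - p)) = x powr (- v) * x powr p" by (simp flip: powr_add)
  then show ?thesis
    using assms by (simp only: damp0_eq less_imp_le) (auto intro!: derivative_eq_intros simp: algebra_simps)
qed

lemma theta_sums_deriv:
  assumes "p > 0" "Re a > 0"
  shows "(\<lambda>n. damp p (of_real v) a 0 (real (Suc n))) sums theta p v a"
    and "(theta p v has_field_derivative - theta p (v - p) a) (at a)"
proof -
  let ?S = "{a. Re a > 0}"
  have "\<exists>g g'. \<forall>a\<in>?S. (\<lambda>n. damp p (of_real v) a 0 (real (Suc n))) sums g a \<and>
      (\<lambda>n. - damp p (of_real (v - p)) a 0 (real (Suc n))) sums g' a \<and> (g has_field_derivative g' a) (at a)" for v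
  proof (rule series_and_derivative_comparison_local)
    show "open ?S" by (rule open_halfspace_Re_gt)
    show "((\<lambda>a. damp p (of_real v) a 0 (real (Suc n))) has_field_derivative - damp p (of_real (v - p)) a 0 (real (Suc n))) (at a)" for n a
      by (intro damp0_deriv) auto
    fix a assume a: "a \<in> ?S"
    obtain C where C: "C \<ge> 0" "\<And>b x. Re b \<ge> Re a / 2 \<Longrightarrow> x \<ge> 1 \<Longrightarrow> norm (damp p (of_real v) b 0 x) \<le> C * x powr (-2)"
      using damp0_decay[of p "Re a / 2" "of_real v"] a assms by auto
    have "Re b \<ge> Re a / 2" if "b \<in> ball a (Re a / 2)" for b
      using abs_Re_le_cmod[of "a - b"] that by (auto simp: dist_norm)
    then have "\<forall>b\<in>ball a (Re a / 2) \<inter> ?S. norm (damp p (of_real v) b 0 (real (Suc n))) \<le> C * real (Suc n) powr (-2)" for n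
      by (intro ballI C(2)) auto
    moreover have "summable (\<lambda>n. C * real (Suc n) powr (-2))"
      by (intro summable_mult summable_Suc_powr) auto
    ultimately show "\<exists>d h. 0 < d \<and> summable h \<and> (\<forall>\<^sub>F n in sequentially. \<forall>y\<in>ball a d \<inter> ?S. norm (damp p (of_real v) y 0 (real (Suc n))) \<le> h n)"
      using a by (intro exI[of _ "Re a / 2"] exI[of _ "\<lambda>n. C * real (Suc n) powr (-2)"]) auto
  qed
  then have *: "\<exists>g g'. \<forall>a\<in>?S. (\<lambda>n. damp p (of_real v) a 0 (real (Suc n))) sums g a \<and>
      (\<lambda>n. - damp p (of_real (v - p)) a 0 (real (Suc n))) sums g' a \<and> (g has_field_derivative g' a) (at a)" for v
    by blast
  have sums: "(\<lambda>n. damp p (of_real v) b 0 (real (Suc n))) sums theta p v b" if "Re b > 0" for v b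
    using *[of v] that unfolding theta_def by (blast intro: summable_sums sums_summable)
  then show "(\<lambda>n. damp p (of_real v) a 0 (real (Suc n))) sums theta p v a" using assms by blast
  obtain g g' where g: "\<And>b. b \<in> ?S \<Longrightarrow> (\<lambda>n. damp p (of_real v) b 0 (real (Suc n))) sums g b \<and>
      (\<lambda>n. - damp p (of_real (v - p)) b 0 (real (Suc n))) sums g' b \<and> (g has_field_derivative g' b) (at b)"
    using *[of v] by blast
  have geq: "g b = theta p v b" if "b \<in> ?S" for b
    using g[OF that] sums[of b v] that sums_unique2 by blast
  have g'eq: "g' a = - theta p (v - p) a"
    using g[of a] sums_minus[OF sums[of a "v - p"]] assms sums_unique2 by blast
  show "(theta p v has_field_derivative - theta p (v - p) a) (at a)"
  proof (rule has_field_derivative_transform_within_open)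
    have "(g has_field_derivative g' a) (at a)" using g[of a] assms by simp
    then show "(g has_field_derivative - theta p (v - p) a) (at a)" by (simp only: g'eq)
    show "open ?S" by (rule open_halfspace_Re_gt)
    show "a \<in> ?S" using assms by simp
  qed (rule geq)
qed

definition unit_int :: "real \<Rightarrow> real \<Rightarrow> real \<Rightarrow> complex \<Rightarrow> complex" where
  "unit_int p v l a = integral {0..1} (\<lambda>t. damp p (of_real v) a 0 (l + t))"

text \<open>
  The left end \<open>l = 0\<close> is admitted for \<open>v < 0\<close>, where \<open>x powr (- v)\<close> extends continuously by \<open>0\<close>; this
  covers the integral over \<open>[0, 1]\<close> that is removed from the Gamma integral.
\<close>

lemma continuous_damp0_shift:
  assumes "l > 0 \<or> (l = 0 \<and> v < 0)" "p > 0"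
  shows "continuous_on (UNIV \<times> {0..1}) (\<lambda>(a, t). damp p (of_real v) a 0 (l + t))"
proof -
  have "continuous_on (UNIV \<times> {0..1}) (\<lambda>(a::complex, t). of_real ((l + t) powr (- v)) * exp (- a * of_real ((l + t) powr p)))"
  proof -
    have "continuous_on (UNIV \<times> {0..1}) (\<lambda>x::complex \<times> real. (l + snd x) powr (- v))"
      using assms by (intro continuous_on_powr' continuous_intros) auto
    moreover have "continuous_on (UNIV \<times> {0..1}) (\<lambda>x::complex \<times> real. (l + snd x) powr p)"
      using assms by (intro continuous_on_powr' continuous_intros) auto
    ultimately show ?thesis
      unfolding case_prod_unfold
      by (intro continuous_on_mult continuous_on_of_real continuous_on_exp continuous_on_minus continuous_on_fst continuous_on_id)
  qed
  then show ?thesis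
    by (rule continuous_on_eq) (use assms in \<open>auto simp: damp0_eq\<close>)
qed

lemma holomorphic_unit_int:
  assumes "l > 0 \<or> (l = 0 \<and> v < 0)" "p > 0"
  shows "unit_int p v l holomorphic_on A"
proof -
  have d: "((\<lambda>a. damp p (of_real v) a 0 x) has_field_derivative - damp p (of_real (v - p)) a 0 x) (at a within S)"
    if "x \<ge> 0" for x a S
  proof (cases "x = 0")
    case True
    then show ?thesis by (simp add: damp_def)
  next
    case False
    with that show ?thesis by (intro damp0_deriv) auto
  qed
  have "(\<lambda>a. integral (cbox 0 1) (\<lambda>t. damp p (of_real v) a 0 (l + t))) holomorphic_on UNIV"
  proof (rule leibniz_rule_holomorphic)
    show "((\<lambda>a. damp p (of_real v) a 0 (l + t)) has_field_derivative - damp p (of_real (v - p)) a 0 (l + t)) (at a within UNIV)"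
      if "t \<in> cbox 0 1" for a t
      using that assms by (intro d) auto
    show "(\<lambda>t. damp p (of_real v) a 0 (l + t)) integrable_on cbox 0 1" for a
    proof -
      have "continuous_on {0..1} (\<lambda>t. (a, t))" by (intro continuous_intros)
      from continuous_on_compose2[OF continuous_damp0_shift[OF assms] this] show ?thesis
        by (auto intro!: integrable_continuous_real)
    qed
    have "l > 0 \<or> (l = 0 \<and> v - p < 0)" using assms by auto
    from continuous_damp0_shift[OF this assms(2)]
    show "continuous_on (UNIV \<times> cbox 0 1) (\<lambda>(a, t). - damp p (of_real (v - p)) a 0 (l + t))"
      by (auto simp: case_prod_unfold intro!: continuous_intros)
  qed auto
  then show ?thesis unfolding unit_int_def[abs_def] by (auto intro: holomorphic_on_subset)
qed

section \<open>The integral over the half-line and the singular part\<close>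

lemma set_sums_intervals:
  fixes f :: "real \<Rightarrow> real"
  assumes "f absolutely_integrable_on {l<..}"
  shows "(\<lambda>n. integral {0..1} (\<lambda>t. f (l + real n + t))) sums integral {l<..} f"
proof -
  have sub: "f absolutely_integrable_on {l<..l + real n}" for n
    using assms by (rule set_integrable_subset) auto
  have U: "(\<Union>n. {l<..l + real n}) = {l<..}"
  proof (intro equalityI subsetI)
    fix x assume "x \<in> {l<..}"
    moreover obtain n :: nat where "x - l \<le> real n" using real_arch_simple by blast
    ultimately show "x \<in> (\<Union>n. {l<..l + real n})" by (auto intro!: exI[of _ n])
  qed auto
  have "(\<lambda>n. LINT x:{l<..l + real n}|lebesgue. f x) \<longlonglongrightarrow> (LINT x:(\<Union>n. {l<..l + real n})|lebesgue. f x)"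
    by (rule set_integral_cont_up) (use assms U in \<open>auto simp: incseq_def\<close>)
  then have lim: "(\<lambda>n. integral {l<..l + real n} f) \<longlonglongrightarrow> integral {l<..} f"
    using assms sub by (simp add: U set_lebesgue_integral_eq_integral)
  have int: "f integrable_on {l..l + real n}" for n
    using set_lebesgue_integral_eq_integral(1)[OF sub[of n]]
    by (rule integrable_spike_set) (auto intro: negligible_subset[of "{l}"])
  have "integral {l..l + real n} f = (\<Sum>i<n. integral {0..1} (\<lambda>t. f (l + real i + t)))" for n
  proof (induction n)
    case (Suc n)
    have "integral {l..l + real (Suc n)} f = integral {l..l + real n} f + integral {l + real n..l + real (Suc n)} f"
      by (rule Henstock_Kurzweil_Integration.integral_combine[symmetric]) (use int[of "Suc n"] in auto)
    also have "integral {l + real n..l + real (Suc n)} f = integral {0..1} (\<lambda>t. f (l + real n + t))"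
      using integral_shift_Icc_real[of 0 1 f "l + real n"] by (simp add: o_def add_ac)
    finally show ?case using Suc by simp
  qed simp
  moreover have "integral {l<..l + real n} f = integral {l..l + real n} f" for n
    by (rule integral_spike_set) (auto intro: negligible_subset[of "{l}"])
  ultimately show ?thesis using lim by (simp add: sums_def)
qed

text \<open>
  The substitution \<open>t = a x\<^sup>p\<close> in Euler's integral for the Gamma function.
\<close>

lemma gamma_substitution:
  fixes a p v :: real
  assumes "a > 0" "p > 0" "v < 1"
  shows "(\<lambda>x. x powr (- v) * exp (- a * x powr p)) absolutely_integrable_on {0<..}"
    and "integral {0<..} (\<lambda>x. x powr (- v) * exp (- a * x powr p)) = 1 / p * Gamma ((1 - v) / p) * a powr ((v - 1) / p)"
proof -
  define z where "z = (1 - v) / p"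
  have z: "z > 0" using assms by (simp add: z_def)
  define h where "h = (\<lambda>t::real. t powr (z - 1) / exp t)"
  have "(h has_integral Gamma z) {0..}" unfolding h_def using Gamma_integral_real[OF z] .
  then have hi: "(h has_integral Gamma z) {0<..}"
    by (rule has_integral_spike_set_eq[THEN iffD1, rotated -1]) (auto intro: negligible_subset[of "{0}"])
  then have habs: "h absolutely_integrable_on {0<..}"
    by (intro nonnegative_absolutely_integrable_1) (auto simp: h_def)
  have im: "(\<lambda>x. a * x powr p) ` {0<..} = {0<..}"
  proof (intro equalityI subsetI)
    fix y :: real assume "y \<in> {0<..}"
    then have "y = a * ((y / a) powr (1 / p)) powr p" "(y / a) powr (1 / p) \<in> {0<..}"
      using assms by (auto simp: powr_powr)
    then show "y \<in> (\<lambda>x. a * x powr p) ` {0<..}" by (rule image_eqI)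
  qed (use assms in auto)
  have der: "((\<lambda>x. a * x powr p) has_field_derivative a * (p * x powr (p - 1))) (at x within {0<..})" if "x \<in> {0<..}" for x
    using that by (auto intro!: derivative_eq_intros)
  have inj: "inj_on (\<lambda>x. a * x powr p) {0<..}"
  proof (rule inj_on_inverseI)
    show "(a * x powr p / a) powr (1 / p) = x" if "x \<in> {0<..}" for x
      using that assms by (simp add: powr_powr)
  qed
  have eq: "\<bar>a * (p * x powr (p - 1))\<bar> * h (a * x powr p) = (p * a powr z) * (x powr (- v) * exp (- a * x powr p))"
    if "x \<in> {0<..}" for x
  proof -
    have "p * z = 1 - v" using assms by (simp add: z_def)
    then have "p - 1 + p * (z - 1) = - v" by (simp add: algebra_simps)
    then have v: "x powr (p - 1) * x powr (p * (z - 1)) = x powr (- v)"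
      by (simp only: powr_add[symmetric])
    have az: "a * a powr (z - 1) = a powr z" using assms by (simp add: powr_diff)
    have hx: "h (a * x powr p) = a powr (z - 1) * x powr (p * (z - 1)) * exp (- a * x powr p)"
      using that assms by (simp add: h_def powr_mult powr_powr exp_minus divide_inverse)
    have "\<bar>a * (p * x powr (p - 1))\<bar> = a * (p * x powr (p - 1))"
      using assms by (intro abs_of_nonneg mult_nonneg_nonneg) auto
    then show ?thesis unfolding hx v[symmetric] az[symmetric] by (simp only: mult_ac)
  qed
  have "(\<lambda>x. \<bar>a * (p * x powr (p - 1))\<bar> * h (a * x powr p)) absolutely_integrable_on {0<..} \<and>
      integral {0<..} (\<lambda>x. \<bar>a * (p * x powr (p - 1))\<bar> * h (a * x powr p)) = Gamma z"
    using has_absolute_integral_change_of_variables_1'[OF _ der inj, of h "Gamma z"] hi habs im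
    by (simp add: integral_unique)
  also have "(\<lambda>x. \<bar>a * (p * x powr (p - 1))\<bar> * h (a * x powr p)) absolutely_integrable_on {0<..}
     \<longleftrightarrow> (\<lambda>x. (p * a powr z) * (x powr (- v) * exp (- a * x powr p))) absolutely_integrable_on {0<..}"
    by (intro set_integrable_cong refl eq)
  also have "integral {0<..} (\<lambda>x. \<bar>a * (p * x powr (p - 1))\<bar> * h (a * x powr p)) =
     integral {0<..} (\<lambda>x. (p * a powr z) * (x powr (- v) * exp (- a * x powr p)))"
    by (intro integral_cong eq)
  finally have *: "(\<lambda>x. (p * a powr z) * (x powr (- v) * exp (- a * x powr p))) absolutely_integrable_on {0<..}"
    "integral {0<..} (\<lambda>x. (p * a powr z) * (x powr (- v) * exp (- a * x powr p))) = Gamma z" by auto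
  have nz: "p * a powr z \<noteq> 0" using assms by auto
  show "(\<lambda>x. x powr (- v) * exp (- a * x powr p)) absolutely_integrable_on {0<..}"
    using *(1) nz by (simp add: set_integrable_mult_right_iff)
  let ?I = "integral {0<..} (\<lambda>x. x powr (- v) * exp (- a * x powr p))"
  have "(p * a powr z) * ?I = Gamma z" using *(2) by simp
  then have "?I = Gamma z / (p * a powr z)"
    using nz by (simp add: eq_divide_eq mult.commute)
  also have "\<dots> = 1 / p * Gamma z * a powr (- z)"
    by (simp add: powr_minus divide_inverse)
  also have "- z = (v - 1) / p"
    by (simp add: z_def minus_divide_left)
  finally show "?I = 1 / p * Gamma ((1 - v) / p) * a powr ((v - 1) / p)"
    by (simp add: z_def)
qed

definition pole_term :: "real \<Rightarrow> real \<Rightarrow> complex \<Rightarrow> complex" where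
  "pole_term p v a = 1 / of_real p * Gamma (of_real ((1 - v) / p)) * a powr of_real ((v - 1) / p)"

lemma unit_int_of_real:
  assumes "l \<ge> 0" "(\<lambda>t. (l + t) powr (- v) * exp (- a * (l + t) powr p)) integrable_on {0..1}"
  shows "unit_int p v l (of_real a) = of_real (integral {0..1} (\<lambda>t. (l + t) powr (- v) * exp (- a * (l + t) powr p)))"
proof -
  have "unit_int p v l (of_real a) = integral {0..1} (\<lambda>t. complex_of_real ((l + t) powr (- v) * exp (- a * (l + t) powr p)))"
    unfolding unit_int_def using assms
    by (intro integral_cong) (simp add: damp0_eq flip: exp_of_real)
  also have "\<dots> = of_real (integral {0..1} (\<lambda>t. (l + t) powr (- v) * exp (- a * (l + t) powr p)))"
    by (intro integral_unique has_integral_of_real integrable_integral assms)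
  finally show ?thesis .
qed

lemma integrable_unit:
  fixes f :: "real \<Rightarrow> real"
  assumes "f absolutely_integrable_on {m<..}" "l \<ge> m"
  shows "(\<lambda>t. f (l + t)) integrable_on {0..1}"
proof -
  have "f absolutely_integrable_on {l<..l + 1}"
    by (rule set_integrable_subset[OF assms(1)]) (use assms in auto)
  then have "f integrable_on {l<..l + 1}"
    by (rule set_lebesgue_integral_eq_integral)
  then have "f integrable_on {l..l + 1}"
    by (rule integrable_spike_set) (auto intro: negligible_subset[of "{l}"])
  then show ?thesis
    using integrable_on_shift_Icc_real[of f l 0 1] by (simp add: o_def add_ac)
qed

lemma unit_int_sums_real:
  assumes "a > 0" "p > 0" "v < 1"
  shows "(\<lambda>n. unit_int p v (real (Suc n)) (of_real a)) sums (pole_term p v (of_real a) - unit_int p v 0 (of_real a))"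
proof -
  let ?f = "\<lambda>x. x powr (- v) * exp (- a * x powr p)"
  note g = gamma_substitution[OF assms]
  have eq: "unit_int p v (real n) (of_real a) = of_real (integral {0..1} (\<lambda>t. ?f (real n + t)))" for n
    by (intro unit_int_of_real integrable_unit[OF g(1)]) auto
  have "(\<lambda>n. integral {0..1} (\<lambda>t. ?f (0 + real n + t))) sums integral {0<..} ?f"
    by (rule set_sums_intervals[OF g(1)])
  then have "(\<lambda>n. unit_int p v (real n) (of_real a)) sums of_real (integral {0<..} ?f)"
    unfolding eq by (simp add: sums_of_real_iff)
  also have "of_real (integral {0<..} ?f) = pole_term p v (of_real a)"
    unfolding g(2) pole_term_def Gamma_complex_of_real powr_of_real[OF less_imp_le[OF assms(1)]]
    by simp
  finally show ?thesis
    using sums_Suc_iff[of "\<lambda>n. unit_int p v (real n) (of_real a)"] by (simp del: of_nat_Suc)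
qed

lemma pole_term_deriv:
  assumes "p > 0" "Re a > 0"
    and "(1 - v) / p \<notin> \<int>\<^sub>\<le>\<^sub>0"
  shows "(pole_term p v has_field_derivative - pole_term p (v - p) a) (at a)"
proof -
  let ?z = "complex_of_real ((1 - v) / p)"
  have e1: "complex_of_real ((1 - (v - p)) / p) = ?z + 1" "complex_of_real ((v - p - 1) / p) = complex_of_real ((v - 1) / p) - 1"
    using assms by (simp_all add: field_simps)
  have "complex_of_real x \<in> \<int>\<^sub>\<le>\<^sub>0 \<longleftrightarrow> x \<in> \<int>\<^sub>\<le>\<^sub>0" for x
    by (rule of_real_in_nonpos_Ints_iff)
  then have G: "Gamma (?z + 1) = ?z * Gamma ?z"
    using assms by (intro Gamma_plus1) (auto simp del: of_real_divide of_real_diff)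
  have m: "complex_of_real ((v - 1) / p) = - ?z"
    by (simp flip: of_real_minus add: minus_divide_left)
  have a: "a \<notin> \<real>\<^sub>\<le>\<^sub>0" using assms by (auto simp: complex_nonpos_Reals_iff)
  have "(pole_term p v has_field_derivative 1 / of_real p * Gamma ?z * (complex_of_real ((v - 1) / p) * a powr (complex_of_real ((v - 1) / p) - 1))) (at a)"
    unfolding pole_term_def[abs_def] by (intro DERIV_cmult has_field_derivative_powr a)
  also have "1 / of_real p * Gamma ?z * (complex_of_real ((v - 1) / p) * a powr (complex_of_real ((v - 1) / p) - 1)) = - pole_term p (v - p) a"
    unfolding pole_term_def e1 G unfolding m by (simp add: mult_ac)
  finally show ?thesis .
qed

lemma holomorphic_pole_term: "pole_term p v holomorphic_on {a. Re a > 0}"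
  unfolding pole_term_def[abs_def]
  by (intro holomorphic_intros) (auto simp: complex_nonpos_Reals_iff)

text \<open>
  Both sides are holomorphic in the right half-plane and agree for real \<open>a\<close>, so no contour has to be rotated.
\<close>

lemma unit_int_sums:
  assumes "Re a > 0" "p > 0" "v < 0"
  shows "(\<lambda>n. unit_int p v (real (Suc n)) a) sums (pole_term p v a - unit_int p v 0 a)"
proof -
  let ?S = "{a. Re a > 0}"
  have "\<exists>g g'. \<forall>a\<in>?S. (\<lambda>n. unit_int p v (real (Suc n)) a) sums g a \<and>
      (\<lambda>n. deriv (unit_int p v (real (Suc n))) a) sums g' a \<and> (g has_field_derivative g' a) (at a)"
  proof (rule series_and_derivative_comparison_local)
    show "open ?S" by (rule open_halfspace_Re_gt)
    show "(unit_int p v (real (Suc n)) has_field_derivative deriv (unit_int p v (real (Suc n))) a) (at a)" for n a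
      using holomorphic_unit_int[of "real (Suc n)" v p UNIV] assms
      by (intro holomorphic_derivI[of _ UNIV]) auto
    fix a assume a: "a \<in> ?S"
    obtain C where C: "C \<ge> 0" "\<And>b x. Re b \<ge> Re a / 2 \<Longrightarrow> x \<ge> 1 \<Longrightarrow> norm (damp p (of_real v) b 0 x) \<le> C * x powr (-2)"
      using damp0_decay[of p "Re a / 2" "of_real v"] a assms by auto
    have Re: "Re b \<ge> Re a / 2" if "b \<in> ball a (Re a / 2)" for b
      using abs_Re_le_cmod[of "a - b"] that by (auto simp: dist_norm)
    have "norm (unit_int p v (real (Suc n)) b) \<le> C * real (Suc n) powr (-2)" if "b \<in> ball a (Re a / 2)" for n b
    proof -
      have "norm (damp p (of_real v) b 0 (real (Suc n) + t)) \<le> C * real (Suc n) powr (-2)" if "t \<in> {0..1}" for t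
      proof -
        have "norm (damp p (of_real v) b 0 (real (Suc n) + t)) \<le> C * (real (Suc n) + t) powr (-2)"
          using that \<open>b \<in> _\<close> by (intro C(2) Re) auto
        also have "\<dots> \<le> C * real (Suc n) powr (-2)"
          using that C by (intro mult_left_mono powr_mono2') auto
        finally show ?thesis .
      qed
      then have "norm (unit_int p v (real (Suc n)) b) \<le> C * real (Suc n) powr (-2) * (1 - 0)"
        unfolding unit_int_def by (intro integral_bound continuous_on_damp_shift) auto
      then show ?thesis by simp
    qed
    moreover have "summable (\<lambda>n. C * real (Suc n) powr (-2))"
      by (intro summable_mult summable_Suc_powr) auto
    ultimately show "\<exists>d h. 0 < d \<and> summable h \<and> (\<forall>\<^sub>F n in sequentially. \<forall>y\<in>ball a d \<inter> ?S. norm (unit_int p v (real (Suc n)) y) \<le> h n)"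
      using a by (intro exI[of _ "Re a / 2"] exI[of _ "\<lambda>n. C * real (Suc n) powr (-2)"]) (auto simp del: of_nat_Suc)
  qed
  then obtain g g' where g: "\<And>a. a \<in> ?S \<Longrightarrow> (\<lambda>n. unit_int p v (real (Suc n)) a) sums g a"
      and g': "\<And>a. a \<in> ?S \<Longrightarrow> (g has_field_derivative g' a) (at a)" by blast
  have "g holomorphic_on ?S"
    using g' by (auto simp: holomorphic_on_open open_halfspace_Re_gt)
  then have hol: "(\<lambda>a. g a - (pole_term p v a - unit_int p v 0 a)) holomorphic_on ?S"
    using assms by (intro holomorphic_on_diff holomorphic_pole_term holomorphic_unit_int) auto
  have "g a - (pole_term p v a - unit_int p v 0 a) = 0"
  proof (rule analytic_continuation[OF hol, of "of_real ` {0<..}" 1])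
    show "open ?S" "connected ?S"
      by (auto intro: open_halfspace_Re_gt convex_connected convex_halfspace_Re_gt)
    show "(1::complex) islimpt complex_of_real ` {0<..}"
    proof (rule islimptI)
      fix T :: "complex set" assume "1 \<in> T" "open T"
      then obtain e where e: "e > 0" "ball 1 e \<subseteq> T" by (auto simp: open_contains_ball)
      have "complex_of_real (1 + e / 2) \<in> ball 1 e" using e by (auto simp: dist_norm)
      moreover have "complex_of_real (1 + e / 2) \<noteq> 1" using e by (simp add: complex_eq_iff)
      ultimately show "\<exists>y\<in>of_real ` {0<..}. y \<in> T \<and> y \<noteq> 1"
        using e by (intro bexI[of _ "complex_of_real (1 + e / 2)"] conjI) (auto intro!: imageI simp del: of_real_add)
    qed
    show "g z - (pole_term p v z - unit_int p v 0 z) = 0" if "z \<in> of_real ` {0<..}" for z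
    proof -
      obtain x where x: "x > 0" "z = of_real x" using \<open>z \<in> _\<close> by auto
      have "g z = pole_term p v z - unit_int p v 0 z"
        using g[of z] unit_int_sums_real[of x p v] x assms sums_unique2 by auto
      then show ?thesis by simp
    qed
  qed (use assms in auto)
  then show ?thesis using g[of a] assms by simp
qed

section \<open>Behaviour of the regular part in sectors\<close>

lemma em_rem_cone_summable:
  assumes "c > 0" "v > - real r"
  shows "\<exists>h. summable h \<and> (\<forall>a n. c * norm a \<le> Re a \<longrightarrow> norm (em_rem r p (of_real v) a n) \<le> h n)"
proof -
  obtain B where B: "B \<ge> 0" "\<And>p s a n C v. C \<ge> 0 \<Longrightarrow> v \<ge> 0 \<Longrightarrow> (\<And>x. x \<ge> 1 \<Longrightarrow> norm (damp p s a (Suc r) x) \<le> C * x powr (- v)) \<Longrightarrow>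
     norm (em_rem r p s a n) \<le> B * C * real (Suc n) powr (- v)"
    using em_rem_bound[of r] by blast
  obtain C where C: "C \<ge> 0" "\<And>a x. c * norm a \<le> Re a \<Longrightarrow> x > 0 \<Longrightarrow>
      norm (damp p (of_real v) a (Suc r) x) \<le> C * x powr (- v - real (Suc r))"
    using damp_cone_bound[OF assms(1), of p "of_real v" "Suc r"] by auto
  have e: "- v - real (Suc r) = - (v + real (Suc r))" by simp
  have "norm (em_rem r p (of_real v) a n) \<le> B * C * real (Suc n) powr (- (v + real (Suc r)))" if "c * norm a \<le> Re a" for a n
  proof (rule B(2))
    show "norm (damp p (of_real v) a (Suc r) x) \<le> C * x powr - (v + real (Suc r))" if "x \<ge> 1" for x
      unfolding e[symmetric] using \<open>x \<ge> 1\<close> by (intro C(2) \<open>c * norm a \<le> Re a\<close>) auto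
  qed (use C(1) assms in auto)
  moreover have "summable (\<lambda>n. B * C * real (Suc n) powr (- (v + real (Suc r))))"
    using assms by (intro summable_mult summable_Suc_powr) auto
  ultimately show ?thesis by blast
qed

lemma em_regular_bounded:
  assumes "c > 0" "v > - real r"
  shows "\<exists>C. \<forall>a. c * norm a \<le> Re a \<longrightarrow> norm (em_regular r p (of_real v) a) \<le> C"
proof -
  obtain h where h: "summable h" "\<And>a n. c * norm a \<le> Re a \<Longrightarrow> norm (em_rem r p (of_real v) a n) \<le> h n"
    using em_rem_cone_summable[OF assms, of p] by blast
  have "\<forall>j. \<exists>C. \<forall>a. c * norm a \<le> Re a \<longrightarrow> norm (damp p (of_real v) a j 1) \<le> C"
  proof
    fix j
    obtain C where "\<And>a x. c * norm a \<le> Re a \<Longrightarrow> x > 0 \<Longrightarrow>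
      norm (damp p (of_real v) a j x) \<le> C * x powr (- v - real j)"
      using damp_cone_bound[OF assms(1), of p "of_real v" j] by auto
    from this[of _ 1] show "\<exists>C. \<forall>a. c * norm a \<le> Re a \<longrightarrow> norm (damp p (of_real v) a j 1) \<le> C"
      by auto
  qed
  then obtain C where C: "\<And>j a. c * norm a \<le> Re a \<Longrightarrow> norm (damp p (of_real v) a j 1) \<le> C j"
    by metis
  have "norm (em_regular r p (of_real v) a) \<le> suminf h + (\<Sum>j<r. \<bar>em_coeff j\<bar> * C j)" if "c * norm a \<le> Re a" for a
  proof -
    have "norm (\<Sum>n. em_rem r p (of_real v) a n) \<le> suminf h"
      by (rule norm_suminf_le) (use h that in auto)
    moreover have "norm (\<Sum>j<r. em_coeff j *\<^sub>R damp p (of_real v) a j 1) \<le> (\<Sum>j<r. \<bar>em_coeff j\<bar> * C j)"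
      by (rule order_trans[OF norm_sum sum_mono]) (auto intro!: mult_left_mono C that)
    ultimately show ?thesis
      unfolding em_regular_def by (intro order_trans[OF norm_triangle_ineq4]) auto
  qed
  then show ?thesis by blast
qed

lemma em_regular_continuous:
  assumes "c > 0" "v > - real r" "p > 0"
  shows "continuous_on {a. c * norm a \<le> Re a} (em_regular r p (of_real v))"
proof -
  let ?S = "{a. c * norm a \<le> Re a}"
  have damp [continuous_intros]: "continuous_on ?S (\<lambda>a. damp p (of_real v) a j x)" for j x
    unfolding damp_def by (intro continuous_intros)
  have unit [continuous_intros]: "continuous_on ?S (unit_int p v (real (Suc n)))" for n
    using assms by (intro holomorphic_on_imp_continuous_on holomorphic_unit_int) auto
  have "em_rem r p (of_real v) a n = damp p (of_real v) a 0 (real (Suc n)) - unit_int p v (real (Suc n)) a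
     - (\<Sum>j<r. em_coeff j *\<^sub>R (damp p (of_real v) a j (real (Suc (Suc n))) - damp p (of_real v) a j (real (Suc n))))" for a n
    using em_damp[of p "of_real v" a n r] unfolding unit_int_def by (simp add: algebra_simps)
  then have rem: "continuous_on ?S (\<lambda>a. em_rem r p (of_real v) a n)" for n
    by (simp only:) (intro continuous_intros)
  obtain h where h: "summable h" "\<And>a n. c * norm a \<le> Re a \<Longrightarrow> norm (em_rem r p (of_real v) a n) \<le> h n"
    using em_rem_cone_summable[OF assms(1,2), of p] by blast
  have "continuous_on ?S (\<lambda>a. \<Sum>n. em_rem r p (of_real v) a n)"
  proof (rule uniform_limit_theorem)
    show "uniform_limit ?S (\<lambda>n a. \<Sum>i<n. em_rem r p (of_real v) a i) (\<lambda>a. \<Sum>n. em_rem r p (of_real v) a n) sequentially"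
      using h by (intro Weierstrass_m_test) auto
  qed (auto intro!: always_eventually continuous_intros rem)
  then show ?thesis
    unfolding em_regular_def[abs_def] by (intro continuous_intros)
qed

lemma theta_minus_int_sums:
  assumes "Re a > 0" "v > - real r" "p > 0"
  shows "(\<lambda>n. damp p (of_real v) a 0 (real (Suc n)) - unit_int p v (real (Suc n)) a) sums em_regular r p (of_real v) a"
  unfolding unit_int_def
proof (rule em_sums)
  fix j
  obtain C where C: "\<And>x. x \<ge> 1 \<Longrightarrow> norm (damp p (of_real v) a j x) \<le> C * x powr (-2)"
    using damp_decay[of p a "of_real v" j] assms by blast
  show "(\<lambda>n. damp p (of_real v) a j (real (Suc n))) \<longlonglongrightarrow> 0"
  proof (rule Lim_null_comparison)
    show "\<forall>\<^sub>F n in sequentially. norm (damp p (of_real v) a j (real (Suc n))) \<le> C * real (Suc n) powr (-2)"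
      by (intro always_eventually allI C) auto
    show "(\<lambda>n. C * real (Suc n) powr (-2)) \<longlonglongrightarrow> 0"
      by (intro tendsto_mult_right_zero powr_Suc_tendsto_0) auto
  qed
next
  define c where "c = Re a / norm a"
  have "norm a > 0" using assms by auto
  then have c: "c > 0" "c * norm a \<le> Re a" using assms by (auto simp: c_def)
  obtain h where h: "summable h"
    "\<forall>a n. c * norm a \<le> Re a \<longrightarrow> norm (em_rem r p (of_real v) a n) \<le> h n"
    using em_rem_cone_summable[OF c(1) assms(2), of p] by blast
  show "summable (em_rem r p (of_real v) a)"
    by (rule summable_comparison_test'[OF h(1)]) (use h(2) c(2) in blast)
qed

section \<open>Boundary values along the positive real axis\<close>

lemma eventually_at_right_0I: "(\<And>x::real. x > 0 \<Longrightarrow> P x) \<Longrightarrow> \<forall>\<^sub>F x in at_right 0. P x"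
  by (simp add: eventually_at_filter)

lemma of_real_tendsto_0: "(complex_of_real \<longlongrightarrow> 0) (at_right 0)"
  using tendsto_of_real[of "\<lambda>x::real. x" 0 "at_right 0"] by (simp add: tendsto_ident_at)

lemma em_regular_tendsto:
  assumes "v > - real r" "p > 0"
  shows "((\<lambda>x. em_regular r p (of_real v) (of_real x)) \<longlongrightarrow> em_regular r p (of_real v) 0) (at_right 0)"
proof (rule continuous_on_tendsto_compose[OF em_regular_continuous[of 1 r v p]])
  show "(complex_of_real \<longlongrightarrow> 0) (at_right 0)"
    by (rule of_real_tendsto_0)
  show "\<forall>\<^sub>F x in at_right 0. complex_of_real x \<in> {a. 1 * norm a \<le> Re a}"
    by (auto simp: eventually_at_filter)
qed (use assms in auto)

lemma unit_int_0_tendsto: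
  assumes "v < 1" "p > 0"
  shows "((\<lambda>x. unit_int p v 0 (of_real x)) \<longlongrightarrow> of_real (1 / (1 - v))) (at_right 0)"
proof -
  let ?d = "\<lambda>a. integral {0..1} (\<lambda>t. t powr (- v) * exp (- a * t powr p))"
  have pw: "((\<lambda>x. x powr (- v)) has_integral 1 / (1 - v)) {0..1}"
    using has_integral_powr_from_0[of "- v" 1] assms by simp
  have int: "(\<lambda>t. t powr (- v) * exp (- a * t powr p)) integrable_on {0..1}" if "a > 0" for a
    using integrable_unit[OF gamma_substitution(1)[OF that assms(2,1)], of 0] by simp
  have lower: "exp (- a) * (1 / (1 - v)) \<le> ?d a" if "a > 0" for a
  proof (rule has_integral_le[OF has_integral_mult_right[OF pw] integrable_integral[OF int[OF that]]])
    fix t :: real assume t: "t \<in> {0..1}"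
    have "t powr p \<le> 1" using t assms by (simp add: powr_le1)
    then have "exp (- a) \<le> exp (- a * t powr p)" using that by simp
    from mult_right_mono[OF this, of "t powr (- v)"]
    show "exp (- a) * t powr (- v) \<le> t powr (- v) * exp (- a * t powr p)" by (simp add: mult.commute)
  qed
  have upper: "?d a \<le> 1 / (1 - v)" if "a > 0" for a
  proof (rule has_integral_le[OF integrable_integral[OF int[OF that]] pw])
    fix t :: real assume t: "t \<in> {0..1}"
    have "exp (- a * t powr p) \<le> 1" using that by simp
    from mult_left_mono[OF this, of "t powr (- v)"]
    show "t powr (- v) * exp (- a * t powr p) \<le> t powr (- v)" by simp
  qed
  have "((\<lambda>a. exp (- a) * (1 / (1 - v))) \<longlongrightarrow> exp (- 0) * (1 / (1 - v))) (at_right 0)"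
    by (intro tendsto_intros)
  then have lim: "((\<lambda>a. exp (- a) * (1 / (1 - v))) \<longlongrightarrow> 1 / (1 - v)) (at_right 0)" by simp
  have "(?d \<longlongrightarrow> 1 / (1 - v)) (at_right 0)"
  proof (rule tendsto_sandwich[OF _ _ lim tendsto_const])
    show "\<forall>\<^sub>F a in at_right 0. exp (- a) * (1 / (1 - v)) \<le> ?d a"
      by (rule eventually_at_right_0I) (rule lower)
    show "\<forall>\<^sub>F a in at_right 0. ?d a \<le> 1 / (1 - v)"
      by (rule eventually_at_right_0I) (rule upper)
  qed
  from tendsto_of_real[OF this]
  have "((\<lambda>x. complex_of_real (?d x)) \<longlongrightarrow> of_real (1 / (1 - v))) (at_right 0)" .
  moreover have "\<forall>\<^sub>F x in at_right 0. complex_of_real (?d x) = unit_int p v 0 (of_real x)"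
  proof -
    have "complex_of_real (?d x) = unit_int p v 0 (of_real x)" if "x > 0" for x
      using unit_int_of_real[of 0 v x p] int[OF that] by simp
    then show ?thesis by (rule eventually_at_right_0I)
  qed
  ultimately show ?thesis by (rule Lim_transform_eventually)
qed

text \<open>
  The difference is the regular part minus the integral over \<open>[0, 1]\<close>; the latter tends to
  \<open>1 / (1 - v)\<close>, which is exactly the pole separating the regular part at \<open>a = 0\<close> from the zeta function.
\<close>

lemma theta_limit_lt1:
  assumes "v < 1" "p > 0"
  shows "((\<lambda>x. theta p v (of_real x) - pole_term p v (of_real x)) \<longlongrightarrow> zeta (of_real v)) (at_right 0)"
proof -
  obtain r :: nat where "- v < real r" using reals_Archimedean2 by blast
  then have r: "v > - real r" by simp
  have "((\<lambda>x. em_regular r p (of_real v) (of_real x) - unit_int p v 0 (of_real x)) \<longlongrightarrow>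
      em_regular r p (of_real v) 0 - of_real (1 / (1 - v))) (at_right 0)"
    using assms r by (intro tendsto_diff em_regular_tendsto unit_int_0_tendsto)
  moreover have "em_regular r p (of_real v) 0 - of_real (1 / (1 - v)) = zeta (of_real v)"
  proof -
    have "zeta (of_real v) = zeta_em r p (of_real v)"
      using assms r by (intro zeta_eq_zeta_em) auto
    moreover have "complex_of_real (1 / (1 - v)) = - (1 / (of_real v - 1))"
      using assms by (simp add: field_simps)
    ultimately show ?thesis by (simp add: zeta_em_def)
  qed
  moreover have "\<forall>\<^sub>F x in at_right 0. em_regular r p (of_real v) (of_real x) - unit_int p v 0 (of_real x)
      = theta p v (of_real x) - pole_term p v (of_real x)"
  proof -
    have "em_regular r p (of_real v) (of_real x) - unit_int p v 0 (of_real x)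
      = theta p v (of_real x) - pole_term p v (of_real x)" if "x > 0" for x
      using sums_unique2[OF theta_minus_int_sums[of "of_real x" r v p]
          sums_diff[OF theta_sums_deriv(1) unit_int_sums_real]] that assms r by simp
    then show ?thesis by (rule eventually_at_right_0I)
  qed
  ultimately show ?thesis by (auto intro: Lim_transform_eventually)
qed

lemma theta_limit_gt1:
  assumes "v > 1" "p > 0"
  shows "((\<lambda>x. theta p v (of_real x)) \<longlongrightarrow> zeta (of_real v)) (at_right 0)"
proof -
  let ?S = "complex_of_real ` {0..}"
  have "continuous_on ?S (theta p v)"
  proof (rule uniform_limit_theorem)
    show "uniform_limit ?S (\<lambda>n a. \<Sum>i<n. damp p (of_real v) a 0 (real (Suc i))) (theta p v) sequentially"
      unfolding theta_def[abs_def]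
    proof (rule Weierstrass_m_test)
      show "norm (damp p (of_real v) a 0 (real (Suc n))) \<le> real (Suc n) powr (- v)" if "a \<in> ?S" for n a
        using that by (subst norm_damp) (auto intro!: mult_left_le simp del: of_nat_Suc)
      show "summable (\<lambda>n. real (Suc n) powr (- v))"
        using assms by (intro summable_Suc_powr)
    qed
    show "\<forall>\<^sub>F n in sequentially. continuous_on ?S (\<lambda>a. \<Sum>i<n. damp p (of_real v) a 0 (real (Suc i)))"
      unfolding damp_def by (intro always_eventually allI continuous_intros)
  qed auto
  then have "((\<lambda>x. theta p v (of_real x)) \<longlongrightarrow> theta p v 0) (at_right 0)"
  proof (rule continuous_on_tendsto_compose)
    show "(complex_of_real \<longlongrightarrow> 0) (at_right 0)"
      by (rule of_real_tendsto_0)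
    show "\<forall>\<^sub>F x in at_right 0. complex_of_real x \<in> ?S"
      by (auto simp: eventually_at_filter)
  qed (auto intro!: image_eqI[of _ _ 0])
  also have "theta p v 0 = zeta (of_real v)"
  proof -
    have "damp p (of_real v) 0 0 (real (Suc n)) = 1 / of_nat (Suc n) powr of_real v" for n
      by (simp add: damp_def powr_minus field_simps)
    then have "theta p v 0 = (\<Sum>n. 1 / of_nat (Suc n) powr of_real v)"
      by (simp only: theta_def)
    also have "\<dots> = zeta_em 0 p (of_real v)"
      using zeta_em_dirichlet[of "of_real v" 0 p] assms by (simp add: sums_iff)
    also have "\<dots> = zeta (of_real v)"
      using assms by (intro zeta_eq_zeta_em[symmetric]) auto
    finally show ?thesis .
  qed
  finally show ?thesis .
qed

text \<open>
  For \<open>v = 1\<close> the integral over \<open>[1, \<infinity>)\<close> depends on \<open>p\<close> only through the factor \<open>1 / p\<close>.  Comparison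
  with \<open>p = 1\<close>, where the series is a logarithm, therefore yields the constant term for every \<open>p\<close>.
\<close>

lemma exponential_integral_substitution:
  assumes "a > 0" "p > (0::real)"
  shows "(\<lambda>x. x powr (- 1) * exp (- a * x powr p)) absolutely_integrable_on {1<..}"
    and "integral {1<..} (\<lambda>x. x powr (- 1) * exp (- a * x powr p)) = 1 / p * integral {1<..} (\<lambda>x. x powr (- 1) * exp (- a * x powr 1))"
proof -
  define h where "h = (\<lambda>x::real. x powr (- 1) * exp (- a * x powr 1))"
  have habs: "h absolutely_integrable_on {1<..}"
  proof (rule measurable_bounded_by_integrable_imp_absolutely_integrable)
    show "h \<in> borel_measurable (lebesgue_on {1<..})"
      unfolding h_def by (intro continuous_imp_measurable_on_sets_lebesgue continuous_intros) auto
    have "(\<lambda>x. x powr (- 0) * exp (- a * x powr 1)) absolutely_integrable_on {1<..}"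
      by (rule set_integrable_subset[OF gamma_substitution(1)[of a 1 0]]) (use assms in auto)
    then show "(\<lambda>x. x powr (- 0) * exp (- a * x powr 1)) integrable_on {1<..}"
      by (rule set_lebesgue_integral_eq_integral)
    show "norm (h x) \<le> x powr (- 0) * exp (- a * x powr 1)" if "x \<in> {1<..}" for x
    proof -
      have "x powr (- 1) \<le> x powr (- 0)" using that by (intro powr_mono) auto
      moreover have "norm (h x) = x powr (- 1) * exp (- a * x powr 1)"
        by (simp add: h_def abs_mult)
      ultimately show ?thesis by (simp only: mult_right_mono exp_ge_zero)
    qed
  qed auto
  have im: "(\<lambda>x. x powr p) ` {1<..} = {1<..}"
  proof (intro equalityI subsetI)
    fix y :: real assume "y \<in> {1<..}"
    then have "y = (y powr (1 / p)) powr p" "y powr (1 / p) \<in> {1<..}"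
      using assms by (auto simp: powr_powr gr_one_powr)
    then show "y \<in> (\<lambda>x. x powr p) ` {1<..}" by (rule image_eqI)
  qed (use assms in \<open>auto simp: gr_one_powr\<close>)
  have der: "((\<lambda>x. x powr p) has_field_derivative p * x powr (p - 1)) (at x within {1<..})" if "x \<in> {1<..}" for x
    using that by (auto intro!: derivative_eq_intros)
  have inj: "inj_on (\<lambda>x. x powr p) {1<..}"
  proof (rule inj_on_inverseI)
    show "(x powr p) powr (1 / p) = x" if "x \<in> {1<..}" for x
      using that assms by (simp add: powr_powr)
  qed
  have eq: "\<bar>p * x powr (p - 1)\<bar> * h (x powr p) = p * (x powr (- 1) * exp (- a * x powr p))"
    if "x \<in> {1<..}" for x
  proof -
    have "x powr (p - 1) * x powr (- p) = x powr (- 1)" by (simp flip: powr_add)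
    moreover have "h (x powr p) = x powr (- p) * exp (- a * x powr p)"
      using that by (simp add: h_def powr_powr powr_minus divide_inverse)
    moreover have "\<bar>p * x powr (p - 1)\<bar> = p * x powr (p - 1)" using assms by simp
    ultimately show ?thesis by (metis mult.assoc)
  qed
  have "(\<lambda>x. \<bar>p * x powr (p - 1)\<bar> * h (x powr p)) absolutely_integrable_on {1<..} \<and>
      integral {1<..} (\<lambda>x. \<bar>p * x powr (p - 1)\<bar> * h (x powr p)) = integral {1<..} h"
    using has_absolute_integral_change_of_variables_1'[OF _ der inj, of h "integral {1<..} h"] habs im
    by simp
  also have "(\<lambda>x. \<bar>p * x powr (p - 1)\<bar> * h (x powr p)) absolutely_integrable_on {1<..}
     \<longleftrightarrow> (\<lambda>x. p * (x powr (- 1) * exp (- a * x powr p))) absolutely_integrable_on {1<..}"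
    by (intro set_integrable_cong refl eq)
  also have "integral {1<..} (\<lambda>x. \<bar>p * x powr (p - 1)\<bar> * h (x powr p)) =
     integral {1<..} (\<lambda>x. p * (x powr (- 1) * exp (- a * x powr p)))"
    by (intro integral_cong eq)
  finally have *: "(\<lambda>x. p * (x powr (- 1) * exp (- a * x powr p))) absolutely_integrable_on {1<..}"
    "integral {1<..} (\<lambda>x. p * (x powr (- 1) * exp (- a * x powr p))) = integral {1<..} h" by auto
  have pn: "p \<noteq> 0" using assms by simp
  then have div: "x = 1 / p * y" if "p * x = y" for x y :: real
    using that by (auto simp: field_simps)
  show "(\<lambda>x. x powr (- 1) * exp (- a * x powr p)) absolutely_integrable_on {1<..}"
    using *(1) by (simp only: set_integrable_mult_right_iff[OF pn])
  have "p * integral {1<..} (\<lambda>x. x powr (- 1) * exp (- a * x powr p)) = integral {1<..} h"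
    using *(2) by (simp only: integral_mult_right)
  then show "integral {1<..} (\<lambda>x. x powr (- 1) * exp (- a * x powr p)) = 1 / p * integral {1<..} (\<lambda>x. x powr (- 1) * exp (- a * x powr 1))"
    unfolding h_def[symmetric] by (rule div)
qed

lemma theta_1_minus_em:
  assumes "a > 0" "p > 0"
  shows "theta p 1 (of_real a) - em_regular 0 p 1 (of_real a)
     = of_real (1 / p * integral {1<..} (\<lambda>x. x powr (- 1) * exp (- a * x powr 1)))"
proof -
  let ?f = "\<lambda>x. x powr (- 1) * exp (- a * x powr p)"
  note s = exponential_integral_substitution[OF assms]
  have eq: "unit_int p 1 (real (Suc n)) (of_real a) = of_real (integral {0..1} (\<lambda>t. ?f (1 + real n + t)))" for n
    using unit_int_of_real[of "1 + real n" 1 a p] integrable_unit[OF s(1), of "1 + real n"] by simp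
  have "(\<lambda>n. unit_int p 1 (real (Suc n)) (of_real a)) sums of_real (integral {1<..} ?f)"
    unfolding eq sums_of_real_iff by (rule set_sums_intervals[OF s(1)])
  from sums_add[OF theta_minus_int_sums[of "of_real a" 0 1 p] this] assms
  have "(\<lambda>n. damp p 1 (of_real a) 0 (real (Suc n))) sums (em_regular 0 p 1 (of_real a) + of_real (integral {1<..} ?f))"
    by simp
  then have "theta p 1 (of_real a) = em_regular 0 p 1 (of_real a) + of_real (integral {1<..} ?f)"
    using theta_sums_deriv(1)[of p "of_real a" 1] assms sums_unique2 by fastforce
  then show ?thesis unfolding s(2) by simp
qed

lemma em_regular_0_1: "em_regular 0 p 1 0 = euler_mascheroni"
proof -
  have "em_rem 0 p 1 0 n = inverse (of_nat (n+1)) + of_real (ln (of_nat (n+1))) - of_real (ln (of_nat (n+2)))" for n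
  proof -
    let ?F = "\<lambda>t. complex_of_real (ln (real (Suc n) + t))"
    have "(?F has_vector_derivative damp p 1 0 0 (real (Suc n) + t)) (at t within {0..1})" if "t \<in> {0..1}" for t
    proof -
      have "((\<lambda>t. ln (real (Suc n) + t)) has_real_derivative inverse (real (Suc n) + t)) (at t within {0..1})"
        using that by (auto intro!: derivative_eq_intros simp: inverse_eq_divide)
      from has_vector_derivative_of_real[OF this]
      have "(?F has_vector_derivative of_real (inverse (real (Suc n) + t))) (at t within {0..1})" .
      moreover have "damp p 1 0 0 (real (Suc n) + t) = of_real (inverse (real (Suc n) + t))"
        using that by (simp add: damp_def powr_minus inverse_eq_divide)
      ultimately show ?thesis by simp
    qed
    from fundamental_theorem_of_calculus[OF _ this]
    have "((\<lambda>t. damp p 1 0 0 (real (Suc n) + t)) has_integral (?F 1 - ?F 0)) {0..1}" by simp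
    then have "damp_int p 1 0 n = ?F 1 - ?F 0" by (rule integral_unique)
    moreover have "damp p 1 0 0 (real (Suc n)) = inverse (of_nat (n + 1))"
      by (simp add: damp_def powr_minus)
    ultimately show ?thesis
      using em_damp[of p 1 0 n 0] by (simp add: algebra_simps)
  qed
  then show ?thesis
    using sums_unique[OF euler_mascheroni_sum[where 'a = complex]] by (simp add: em_regular_def)
qed

lemma theta_1_1:
  assumes "a > 0"
  shows "theta 1 1 (of_real a) = of_real (- ln (1 - exp (- a)))"
proof -
  let ?t = "\<lambda>n. exp (- a) ^ Suc n / real (Suc n)"
  have eq: "damp 1 1 (of_real a) 0 (real (Suc n)) = of_real (?t n)" for n
  proof -
    have "exp (- (complex_of_real a * of_nat (Suc n))) = of_real (exp (- a) ^ Suc n)"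
      by (simp only: exp_of_nat_mult[symmetric] exp_of_real[symmetric] of_real_power[symmetric])
         (simp add: algebra_simps flip: exp_of_real)
    then show ?thesis
      by (simp add: damp_def powr_minus divide_inverse mult_ac del: of_nat_Suc power_Suc)
  qed
  have S: "(\<lambda>n. complex_of_real (?t n)) sums theta 1 1 (of_real a)"
    using theta_sums_deriv(1)[of 1 "of_real a" 1] assms by (simp add: eq del: power_Suc of_nat_Suc)
  have sm: "summable ?t" using sums_summable[OF S] by (simp only: summable_of_real_iff)
  have "(\<lambda>n. complex_of_real (?t n)) sums of_real (suminf ?t)"
    unfolding sums_of_real_iff by (rule summable_sums[OF sm])
  then have "theta 1 1 (of_real a) = of_real (suminf ?t)"
    by (rule sums_unique2[OF S])
  also have "suminf ?t = - ln (1 - exp (- a))"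
  proof -
    have t: "(-1) ^ n * (1 / real (n + 1)) * ((1 - exp (- a)) - 1) ^ Suc n = - ?t n" for n
      using power_mult_distrib[of "-1" "exp (- a)" "Suc n"] by (simp add: field_simps)
    have "ln (1 - exp (- a)) = (\<Sum>n. (-1) ^ n * (1 / real (n + 1)) * ((1 - exp (- a)) - 1) ^ Suc n)"
    proof (rule ln_series)
      have "exp (- a) < 1" "exp (- a) > 0" using assms by simp_all
      then show "0 < 1 - exp (- a)" "1 - exp (- a) < 2" by linarith+
    qed
    also have "\<dots> = - suminf ?t"
      unfolding t by (rule suminf_minus[OF sm])
    finally show ?thesis by simp
  qed
  finally show ?thesis .
qed

lemma theta_limit_1:
  assumes "p > 0"
  shows "((\<lambda>x. theta p 1 (of_real x) + of_real (ln x / p)) \<longlongrightarrow> euler_mascheroni - euler_mascheroni / of_real p) (at_right 0)"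
proof -
  let ?E = "\<lambda>p x. em_regular 0 p 1 (complex_of_real x)"
  have E: "(?E p \<longlongrightarrow> euler_mascheroni) (at_right 0)" if "p > 0" for p
    using em_regular_tendsto[of 0 1 p] that by (simp add: em_regular_0_1)
  have "((\<lambda>x::real. - ln (1 - exp (- x)) + ln x) \<longlongrightarrow> 0) (at_right 0)"
    by real_asymp
  then have L: "((\<lambda>x. complex_of_real (- ln (1 - exp (- x)) + ln x)) \<longlongrightarrow> of_real 0) (at_right 0)"
    by (rule tendsto_of_real)
  have "((\<lambda>x. ?E p x + 1 / of_real p * (of_real (- ln (1 - exp (- x)) + ln x) - ?E 1 x)) \<longlongrightarrow>
      euler_mascheroni + 1 / of_real p * (of_real 0 - euler_mascheroni)) (at_right 0)"
    by (intro tendsto_add tendsto_mult tendsto_diff tendsto_const E L assms zero_less_one)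
  moreover have "\<forall>\<^sub>F x in at_right 0. ?E p x + 1 / of_real p * (of_real (- ln (1 - exp (- x)) + ln x) - ?E 1 x)
      = theta p 1 (of_real x) + of_real (ln x / p)"
  proof -
    have "?E p x + 1 / of_real p * (of_real (- ln (1 - exp (- x)) + ln x) - ?E 1 x)
      = theta p 1 (of_real x) + of_real (ln x / p)" if "x > 0" for x
    proof -
      have "theta p 1 (of_real x) - ?E p x = 1 / of_real p * (theta 1 1 (of_real x) - ?E 1 x)"
        using theta_1_minus_em[OF that assms] theta_1_minus_em[OF that, of 1] by simp
      then show ?thesis unfolding theta_1_1[OF that] by (simp add: algebra_simps)
    qed
    then show ?thesis by (rule eventually_at_right_0I)
  qed
  ultimately show ?thesis by (auto intro: Lim_transform_eventually)
qed

section \<open>The series minus its singular part\<close>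

definition log_term :: "real \<Rightarrow> nat \<Rightarrow> complex \<Rightarrow> complex" where
  "log_term p M a = (- a) ^ M / fact M *
        (euler_mascheroni - 1 / of_real p * Ln a + 1 / of_real p * Digamma (of_nat M + 1))"

lemma J_main_log: "p > 0 \<Longrightarrow> J_main p a (p * real M + 1) = log_term p M a"
proof -
  assume p: "p > 0"
  have "(THE M'::nat. p * real M + 1 = p * real M' + 1) = M"
    using p by (intro the_equality) auto
  then show ?thesis unfolding J_main_def log_term_def by (auto simp: Let_def)
qed

lemma J_main_pole: "(\<And>M::nat. v \<noteq> p * real M + 1) \<Longrightarrow> J_main p a v = pole_term p v a"
  unfolding J_main_def pole_term_def by auto

lemma log_term_deriv_Suc:
  assumes "p > 0" "Re a > 0"
  shows "(log_term p (Suc m) has_field_derivative - log_term p m a) (at a)"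
proof -
  have a: "a \<notin> \<real>\<^sub>\<le>\<^sub>0" "a \<noteq> 0" using assms by (auto simp: complex_nonpos_Reals_iff)
  define L where "L = euler_mascheroni - 1 / of_real p * Ln a + 1 / of_real p * Digamma (of_nat (Suc m) + 1)"
  define c where "c = (- a) ^ m / fact m"
  have f: "fact (Suc m) = (of_nat (Suc m) * fact m :: complex)" by simp
  have n0: "of_nat (Suc m) \<noteq> (0::complex)" by (simp del: of_nat_Suc)
  have "(log_term p (Suc m) has_field_derivative
      (of_nat (Suc m) * (- 1) * (- a) ^ m) / fact (Suc m) * L + (- a) ^ Suc m / fact (Suc m) * (- (1 / of_real p * (1 / a)))) (at a)"
    unfolding log_term_def[abs_def] L_def
    by (rule derivative_eq_intros refl a | simp add: a divide_inverse mult_ac del: of_nat_Suc fact_Suc power_Suc)+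
  also have "(of_nat (Suc m) * (- 1) * (- a) ^ m) / fact (Suc m) * L = - c * L"
    unfolding f c_def using n0 by (simp del: of_nat_Suc)
  also have "(- a) ^ Suc m / fact (Suc m) * (- (1 / of_real p * (1 / a))) = c * (1 / of_real p * (1 / of_nat (Suc m)))"
    unfolding f c_def using n0 a(2) by (simp add: divide_simps del: of_nat_Suc)
  also have "- c * L + c * (1 / of_real p * (1 / of_nat (Suc m))) = - log_term p m a"
  proof -
    have "of_nat (Suc m) + 1 = of_nat m + 1 + (1::complex)" by simp
    then have "Digamma (of_nat (Suc m) + 1 :: complex) = Digamma (of_nat m + 1) + 1 / of_nat (Suc m)"
      using Digamma_plus1[of "of_nat m + 1 :: complex"] n0 by (simp add: add.commute)
    then show ?thesis
      unfolding L_def log_term_def c_def[symmetric] by (simp add: algebra_simps)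
  qed
  finally show ?thesis .
qed

text \<open>
  For \<open>v = 1\<close> differentiation leaves the logarithmic family, since \<open>1 - p\<close> is not of the form \<open>p M + 1\<close>; the
  derivative of \<open>- ln a / p\<close> is \<open>- \<Gamma>(1) / (p a)\<close>.
\<close>

lemma log_term_deriv_0:
  assumes "p > 0" "Re a > 0"
  shows "(log_term p 0 has_field_derivative - pole_term p (1 - p) a) (at a)"
proof -
  have a: "a \<notin> \<real>\<^sub>\<le>\<^sub>0" "a \<noteq> 0" using assms by (auto simp: complex_nonpos_Reals_iff)
  have "(log_term p 0 has_field_derivative - (1 / of_real p * (1 / a))) (at a)"
    unfolding log_term_def[abs_def]
    by (rule derivative_eq_intros refl a | simp add: a divide_inverse mult_ac)+
  also have "1 / of_real p * (1 / a) = pole_term p (1 - p) a"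
    using assms a by (simp add: pole_term_def powr_minus divide_inverse)
  finally show ?thesis .
qed

definition gap :: "real \<Rightarrow> real \<Rightarrow> complex \<Rightarrow> complex" where
  "gap p v a = theta p v a - J_main p a v"

lemma gap_deriv:
  assumes "p > 0" "Re a > 0"
  shows "(gap p v has_field_derivative - gap p (v - p) a) (at a)"
proof -
  have "((\<lambda>a. J_main p a v) has_field_derivative - J_main p a (v - p)) (at a)"
  proof (cases "\<exists>M::nat. v = p * real M + 1")
    case True
    then obtain M :: nat where v: "v = p * real M + 1" by blast
    show ?thesis
    proof (cases M)
      case 0
      have "J_main p a (1 - p) = pole_term p (1 - p) a"
      proof (rule J_main_pole)
        fix M :: nat
        have "p * real M \<ge> 0" using assms by simp
        then show "1 - p \<noteq> p * real M + 1" using assms by linarith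
      qed
      then show ?thesis
        using log_term_deriv_0[OF assms] J_main_log[OF assms(1), of _ 0] v 0 by simp
    next
      case (Suc m)
      have vp: "v - p = p * real m + 1" using v Suc by (simp add: algebra_simps)
      have "J_main p b v = log_term p (Suc m) b" for b
        unfolding v Suc by (rule J_main_log[OF assms(1)])
      moreover have "J_main p a (v - p) = log_term p m a"
        unfolding vp by (rule J_main_log[OF assms(1)])
      ultimately show ?thesis
        using log_term_deriv_Suc[OF assms, of m] by (simp only:)
    qed
  next
    case False
    have z: "(1 - v) / p \<notin> \<int>\<^sub>\<le>\<^sub>0"
    proof
      assume "(1 - v) / p \<in> \<int>\<^sub>\<le>\<^sub>0"
      then obtain n where "(1 - v) / p = - real n" by (auto elim!: nonpos_Ints_cases')
      then have "v = p * real n + 1" using assms by (simp add: field_simps)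
      then show False using False by blast
    qed
    have v': "v - p \<noteq> p * real M + 1" for M :: nat
    proof
      assume "v - p = p * real M + 1"
      then have "v = p * real (Suc M) + 1" by (simp add: algebra_simps)
      then show False using False by blast
    qed
    show ?thesis
      using pole_term_deriv[OF assms z] J_main_pole[of v p] J_main_pole[OF v'] False by simp
  qed
  then show ?thesis
    unfolding gap_def[abs_def] using DERIV_diff[OF theta_sums_deriv(2)[OF assms, of v]] by fastforce
qed

lemma J_main_tendsto_0:
  assumes "p > 0" "v > 1"
  shows "((\<lambda>x. J_main p (of_real x) v) \<longlongrightarrow> 0) (at_right 0)"
proof (cases "\<exists>M::nat. v = p * real M + 1")
  case True
  then obtain M :: nat where v: "v = p * real M + 1" by blast
  then obtain m where M: "M = Suc m" using assms by (cases M) auto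
  define K :: complex where "K = euler_mascheroni + 1 / of_real p * Digamma (of_nat M + 1)"
  have "((\<lambda>x::real. x * ln x) \<longlongrightarrow> 0) (at_right 0)" by real_asymp
  from tendsto_of_real[OF this] have xln: "((\<lambda>x. complex_of_real (x * ln x)) \<longlongrightarrow> of_real 0) (at_right 0)" .
  have "((\<lambda>x. (- complex_of_real x) ^ m / fact M * (- of_real x * K + 1 / of_real p * of_real (x * ln x)))
      \<longlongrightarrow> (- 0) ^ m / fact M * (- 0 * K + 1 / of_real p * of_real 0)) (at_right 0)"
    by (intro tendsto_intros xln of_real_tendsto_0) auto
  then have "((\<lambda>x. (- complex_of_real x) ^ m / fact M * (- of_real x * K + 1 / of_real p * of_real (x * ln x))) \<longlongrightarrow> 0) (at_right 0)"
    by simp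
  moreover have "(- complex_of_real x) ^ m / fact M * (- of_real x * K + 1 / of_real p * of_real (x * ln x)) = J_main p (of_real x) v"
    if "x > 0" for x
    unfolding v J_main_log[OF assms(1)] log_term_def K_def using that
    by (simp add: M Ln_of_real algebra_simps del: fact_Suc)
  ultimately show ?thesis
    by (rule Lim_transform_eventually[OF _ eventually_at_right_0I])
next
  case False
  have "((\<lambda>x::real. x powr ((v - 1) / p)) \<longlongrightarrow> 0 powr ((v - 1) / p)) (at_right 0)"
    using assms by (intro tendsto_powr' tendsto_const tendsto_ident_at) (auto simp: eventually_at_filter)
  from tendsto_of_real[OF this]
  have "((\<lambda>x. complex_of_real (x powr ((v - 1) / p))) \<longlongrightarrow> 0) (at_right 0)" by simp
  from tendsto_mult_left[OF this]
  have "((\<lambda>x. 1 / of_real p * Gamma (of_real ((1 - v) / p)) * complex_of_real (x powr ((v - 1) / p))) \<longlongrightarrow>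
      1 / of_real p * Gamma (of_real ((1 - v) / p)) * 0) (at_right 0)" .
  then have "((\<lambda>x. 1 / of_real p * Gamma (of_real ((1 - v) / p)) * complex_of_real (x powr ((v - 1) / p))) \<longlongrightarrow> 0) (at_right 0)"
    by simp
  moreover have "1 / of_real p * Gamma (of_real ((1 - v) / p)) * complex_of_real (x powr ((v - 1) / p)) = J_main p (of_real x) v"
    if "x > 0" for x
    using False that by (subst J_main_pole) (auto simp: pole_term_def powr_of_real[symmetric] simp del: of_real_divide of_real_diff)
  ultimately show ?thesis
    by (rule Lim_transform_eventually[OF _ eventually_at_right_0I])
qed

text \<open>
  At \<open>v = 1\<close> the Digamma value \<open>- \<gamma>\<close> in the singular part and its term \<open>\<gamma>\<close> together match the constant \<open>\<gamma> - \<gamma> / p\<close> of the series, so that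
  the limit is \<open>0 = zeta 1\<close>.
\<close>

lemma gap_tendsto_zeta:
  assumes "p > 0"
  shows "((\<lambda>x. gap p v (of_real x)) \<longlongrightarrow> zeta (of_real v)) (at_right 0)"
proof (cases v "1::real" rule: linorder_cases)
  case less
  have "J_main p a v = pole_term p v a" for a
  proof (rule J_main_pole)
    fix M :: nat
    have "p * real M \<ge> 0" using assms by simp
    then show "v \<noteq> p * real M + 1" using less by linarith
  qed
  then show ?thesis using theta_limit_lt1[OF less assms] by (simp add: gap_def)
next
  case equal
  have J: "J_main p (of_real x) v = euler_mascheroni - euler_mascheroni / of_real p - of_real (ln x / p)" if "x > 0" for x
    using J_main_log[OF assms, of "of_real x" 0] that equal
    by (simp add: log_term_def Ln_of_real algebra_simps)
  have "((\<lambda>x. (theta p 1 (of_real x) + of_real (ln x / p)) - (euler_mascheroni - euler_mascheroni / of_real p)) \<longlongrightarrow>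
      (euler_mascheroni - euler_mascheroni / of_real p) - (euler_mascheroni - euler_mascheroni / of_real p)) (at_right 0)"
    by (intro tendsto_diff theta_limit_1 tendsto_const assms)
  then have "((\<lambda>x. (theta p 1 (of_real x) + of_real (ln x / p)) - (euler_mascheroni - euler_mascheroni / of_real p)) \<longlongrightarrow>
      zeta (of_real v)) (at_right 0)"
    using zeta_1 equal by simp
  moreover have "(theta p 1 (of_real x) + of_real (ln x / p)) - (euler_mascheroni - euler_mascheroni / of_real p)
      = gap p v (of_real x)" if "x > 0" for x
    unfolding gap_def J[OF that] using equal by simp
  ultimately show ?thesis
    by (rule Lim_transform_eventually[OF _ eventually_at_right_0I])
next
  case greater
  from tendsto_diff[OF theta_limit_gt1[OF this assms] J_main_tendsto_0[OF assms this]]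
  show ?thesis by (simp add: gap_def)
qed

text \<open>
  The bound for \<open>v < 0\<close> is uniform in the whole sector, where the crude estimate of the series by its
  values at \<open>Re a\<close> would only reproduce the order of the singular part.
\<close>

lemma gap_bounded:
  assumes "p > 0" "v < 0" "c > 0"
  shows "\<exists>B. \<forall>a. Re a > 0 \<longrightarrow> c * norm a \<le> Re a \<longrightarrow> norm (gap p v a) \<le> B"
proof -
  obtain r :: nat where "- v < real r" using reals_Archimedean2 by blast
  then have r: "v > - real r" by simp
  obtain C where C: "\<And>a. c * norm a \<le> Re a \<Longrightarrow> norm (em_regular r p (of_real v) a) \<le> C"
    using em_regular_bounded[OF assms(3) r] by blast
  have "norm (gap p v a) \<le> C + 1" if a: "Re a > 0" "c * norm a \<le> Re a" for a
  proof -
    have "J_main p a v = pole_term p v a"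
    proof (rule J_main_pole)
      fix M :: nat
      have "p * real M \<ge> 0" using assms by simp
      then show "v \<noteq> p * real M + 1" using assms by linarith
    qed
    moreover have "em_regular r p (of_real v) a = theta p v a - (pole_term p v a - unit_int p v 0 a)"
      by (rule sums_unique2[OF theta_minus_int_sums sums_diff[OF theta_sums_deriv(1) unit_int_sums]])
         (use assms a r in auto)
    ultimately have gap: "gap p v a = em_regular r p (of_real v) a - unit_int p v 0 a"
      by (simp add: gap_def)
    have "norm (unit_int p v 0 a) \<le> 1 * (1 - 0)"
      unfolding unit_int_def
    proof (rule integral_bound)
      have "continuous_on {0..1} (\<lambda>t. (a, t))" by (intro continuous_intros)
      from continuous_on_compose2[OF continuous_damp0_shift[of 0 v p] this]
      show "continuous_on {0..1} (\<lambda>t. damp p (of_real v) a 0 (0 + t))" using assms by auto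
      show "norm (damp p (of_real v) a 0 (0 + t)) \<le> 1" if "t \<in> {0..1}" for t
      proof -
        have "t powr (- v) \<le> 1" using that assms by (simp add: powr_le1)
        moreover have "exp (- Re a * t powr p) \<le> 1" using a by simp
        ultimately have "t powr (- v) * exp (- Re a * t powr p) \<le> 1"
          by (intro mult_le_one) auto
        then show ?thesis using that by (simp add: damp0_eq norm_mult)
      qed
    qed auto
    then show ?thesis
      unfolding gap using C[OF a(2)] by (intro order_trans[OF norm_triangle_ineq4]) auto
  qed
  then show ?thesis by blast
qed

section \<open>Taylor expansion at the vertex of a sector\<close>

text \<open>
  One integration per step.  The remainder \<open>H\<close> of order \<open>m + 1\<close> has the remainder of order \<open>m\<close> of
  \<open>g (Suc k)\<close> as negative derivative and vanishes along the positive real axis at \<open>0\<close>.  The part of the sector in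
  the disc of radius \<open>norm a\<close> is convex, so the mean value inequality compares \<open>H a\<close> with \<open>H x\<close> for
  real \<open>x\<close> tending to \<open>0\<close>; boundary values are therefore required only along the real axis.
\<close>

lemma cone_taylor:
  fixes g :: "nat \<Rightarrow> complex \<Rightarrow> complex" and z :: "nat \<Rightarrow> complex"
  assumes der: "\<And>k a. Re a > 0 \<Longrightarrow> (g k has_field_derivative - g (Suc k) a) (at a)"
    and lim: "\<And>k. ((\<lambda>x. g k (of_real x)) \<longlongrightarrow> z k) (at_right 0)"
    and bnd: "\<And>a. Re a > 0 \<Longrightarrow> c * norm a \<le> Re a \<Longrightarrow> norm (g (k + m) a) \<le> B"
    and c: "c > 0"
  shows "\<exists>C\<ge>0. \<forall>a. Re a > 0 \<longrightarrow> c * norm a \<le> Re a \<longrightarrow>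
           norm (g k a - (\<Sum>i<m. (- 1) ^ i / fact i * z (k + i) * a ^ i)) \<le> C * norm a ^ m"
  using bnd
proof (induction m arbitrary: k)
  case 0
  then have "\<forall>a. Re a > 0 \<longrightarrow> c * norm a \<le> Re a \<longrightarrow> norm (g k a) \<le> max B 0" by fastforce
  then show ?case by (intro exI[of _ "max B 0"]) auto
next
  case (Suc m)
  have "norm (g (Suc k + m) a) \<le> B" if "Re a > 0" "c * norm a \<le> Re a" for a
    using Suc.prems[OF that] by simp
  from Suc.IH[OF this] obtain C where C: "C \<ge> 0"
    "\<And>a. Re a > 0 \<Longrightarrow> c * norm a \<le> Re a \<Longrightarrow>
       norm (g (Suc k) a - (\<Sum>i<m. (- 1) ^ i / fact i * z (Suc k + i) * a ^ i)) \<le> C * norm a ^ m"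
    by blast
  define H where "H = (\<lambda>a. g k a - (\<Sum>i<Suc m. (- 1) ^ i / fact i * z (k + i) * a ^ i))"
  define H' where "H' = (\<lambda>a. - (g (Suc k) a - (\<Sum>i<m. (- 1) ^ i / fact i * z (Suc k + i) * a ^ i)))"
  have dH: "(H has_field_derivative H' a) (at a)" if "Re a > 0" for a
  proof -
    have "((\<lambda>a. \<Sum>i<Suc m. (- 1) ^ i / fact i * z (k + i) * a ^ i) has_field_derivative
        (\<Sum>i<Suc m. (- 1) ^ i / fact i * z (k + i) * (of_nat i * a ^ (i - 1)))) (at a)"
      by (intro DERIV_sum DERIV_cmult) (auto intro!: derivative_eq_intros)
    also have "(\<Sum>i<Suc m. (- 1) ^ i / fact i * z (k + i) * (of_nat i * a ^ (i - 1)))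
        = (\<Sum>i<m. (- 1) ^ Suc i / fact (Suc i) * z (k + Suc i) * (of_nat (Suc i) * a ^ i))"
      unfolding sum.lessThan_Suc_shift by simp
    also have "\<dots> = - (\<Sum>i<m. (- 1) ^ i / fact i * z (Suc k + i) * a ^ i)"
      unfolding sum_negf[symmetric]
    proof (rule sum.cong)
      fix i
      have "of_nat (Suc i) \<noteq> (0::complex)" by (simp del: of_nat_Suc)
      then show "(- 1) ^ Suc i / fact (Suc i) * z (k + Suc i) * (of_nat (Suc i) * a ^ i)
          = - ((- 1) ^ i / fact i * z (Suc k + i) * a ^ i)"
        by (simp add: fact_Suc divide_simps del: of_nat_Suc)
    qed auto
    finally show ?thesis
      unfolding H_def H'_def using DERIV_diff[OF der[OF that, of k]] by fastforce
  qed
  have "norm (H a) \<le> (C * 2) * norm a ^ Suc m" if a: "Re a > 0" "c * norm a \<le> Re a" for a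
  proof -
    define \<rho> where "\<rho> = norm a"
    have \<rho>: "\<rho> > 0" using a by (auto simp: \<rho>_def)
    have "c * \<rho> \<le> 1 * \<rho>" using a complex_Re_le_cmod[of a] by (simp add: \<rho>_def)
    then have c1: "c \<le> 1" using \<rho> by (simp only: mult_le_cancel_right_pos)
    define S where "S = {b. Re b > 0} \<inter> {b. c * norm b \<le> Re b} \<inter> cball 0 \<rho>"
    have "convex {b. c * norm b \<le> Re b}"
    proof (rule convexI)
      fix x y :: complex and u v :: real
      assume xy: "x \<in> {b. c * norm b \<le> Re b}" "y \<in> {b. c * norm b \<le> Re b}" and uv: "0 \<le> u" "0 \<le> v"
      have "c * norm (u *\<^sub>R x + v *\<^sub>R y) \<le> c * (u * norm x + v * norm y)"
        using norm_triangle_ineq[of "u *\<^sub>R x" "v *\<^sub>R y"] uv c by (intro mult_left_mono) auto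
      also have "\<dots> = u * (c * norm x) + v * (c * norm y)" by (simp add: algebra_simps)
      also have "\<dots> \<le> u * Re x + v * Re y" using xy uv by (intro add_mono mult_left_mono) auto
      finally show "u *\<^sub>R x + v *\<^sub>R y \<in> {b. c * norm b \<le> Re b}" by simp
    qed
    then have cv: "convex S"
      unfolding S_def by (intro convex_Int convex_halfspace_Re_gt convex_cball)
    have "norm (H a - H (of_real x)) \<le> (C * 2) * \<rho> ^ Suc m" if x: "x > 0" "x \<le> \<rho>" for x
    proof -
      have "norm (H a - H (of_real x)) \<le> (C * \<rho> ^ m) * norm (a - of_real x)"
      proof (rule field_differentiable_bound[OF cv])
        show "(H has_field_derivative H' b) (at b within S)" if "b \<in> S" for b
          using dH[of b] that by (auto simp: S_def intro: has_field_derivative_at_within)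
        show "norm (H' b) \<le> C * \<rho> ^ m" if "b \<in> S" for b
        proof -
          have "norm (H' b) \<le> C * norm b ^ m"
            unfolding H'_def norm_minus_cancel using that by (intro C(2)) (auto simp: S_def)
          also have "\<dots> \<le> C * \<rho> ^ m"
            using that C(1) by (intro mult_left_mono power_mono) (auto simp: S_def)
          finally show ?thesis .
        qed
        show "a \<in> S" using a by (auto simp: S_def \<rho>_def)
        show "of_real x \<in> S" using x c1 by (auto simp: S_def mult_left_le_one_le c less_imp_le)
      qed
      also have "\<dots> \<le> (C * \<rho> ^ m) * (2 * \<rho>)"
        using norm_triangle_ineq4[of a "of_real x"] x C(1) \<rho>
        by (intro mult_left_mono) (auto simp: \<rho>_def)
      finally show ?thesis by (simp add: mult_ac)
    qed
    then have ev: "\<forall>\<^sub>F x in at_right 0. norm (H a - H (of_real x)) \<le> (C * 2) * \<rho> ^ Suc m"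
      using eventually_at_right_real[OF \<rho>] by (auto elim!: eventually_mono)
    have "((\<lambda>x. H (of_real x)) \<longlongrightarrow> z k - (\<Sum>i<Suc m. (- 1) ^ i / fact i * z (k + i) * 0 ^ i)) (at_right 0)"
      unfolding H_def by (intro tendsto_diff lim tendsto_sum tendsto_mult tendsto_const tendsto_power of_real_tendsto_0)
    also have "z k - (\<Sum>i<Suc m. (- 1) ^ i / fact i * z (k + i) * 0 ^ i) = 0"
      unfolding sum.lessThan_Suc_shift by simp
    finally have "((\<lambda>x. norm (H a - H (of_real x))) \<longlongrightarrow> norm (H a - 0)) (at_right 0)"
      by (intro tendsto_intros)
    from tendsto_upperbound[OF this ev] show ?thesis by (simp add: \<rho>_def)
  qed
  then show ?case
    using C(1) unfolding H_def by (intro exI[of _ "C * 2"]) auto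
qed

section \<open>The asymptotic expansion\<close>

theorem mainTheorem4:
  fixes p w s\<^sub>0 :: real and N :: nat
  assumes "p > 1" and "w > 0"
    and "\<not> ((\<exists>i::int. even i \<and> w = of_int i) \<and> (\<exists>j::int. even j \<and> p = of_int j))"
    and "s\<^sub>0 = (w - 1) / p"
    and "N > 0" and "real N > s\<^sub>0 + 3 / 2"
  shows "\<exists>R :: complex \<Rightarrow> complex.
    (\<forall>a. a \<noteq> 0 \<and> \<bar>Arg a\<bar> < pi / 2 \<longrightarrow>
       (\<lambda>n. exp (- a * of_real (real (Suc n) powr p)) / of_real (real (Suc n) powr w)) sums
         (J_main p a w
          + (\<Sum>k\<in>{..<N} - {M. w = p * real M + 1}.
               (- 1) ^ k / fact k * zeta (of_real (w - real k * p)) * a ^ k)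
          + R a)) \<and>
    (\<forall>\<delta>. 0 < \<delta> \<and> \<delta> < pi / 2 \<longrightarrow>
       R \<in> O[at 0 within {a. \<bar>Arg a\<bar> \<le> pi / 2 - \<delta>}](\<lambda>a. a powr (of_nat N - 1 / 2)))"
proof -
  have p: "p > 0" using assms(1) by simp
  define z where "z = (\<lambda>k. zeta (of_real (w - real k * p)))"
  define R where "R = (\<lambda>a. gap p w a - (\<Sum>k<N. (- 1) ^ k / fact k * z k * a ^ k))"
  \<comment> \<open>at the omitted index the zeta value is \<open>zeta 1 = 0\<close>\<close>
  have omit: "(\<Sum>k\<in>{..<N} - {M. w = p * real M + 1}. (- 1) ^ k / fact k * zeta (of_real (w - real k * p)) * a ^ k)
      = (\<Sum>k<N. (- 1) ^ k / fact k * z k * a ^ k)" for a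
  proof -
    have z0: "z k = 0" if "w = p * real k + 1" for k
    proof -
      have "w - real k * p = 1" using that by simp
      then show ?thesis
        unfolding z_def using zeta_1 by (simp only: of_real_1)
    qed
    have "(\<Sum>k\<in>{..<N} - {M. w = p * real M + 1}. (- 1) ^ k / fact k * z k * a ^ k) = (\<Sum>k<N. (- 1) ^ k / fact k * z k * a ^ k)"
    proof (rule sum.mono_neutral_left)
      show "\<forall>k\<in>{..<N} - ({..<N} - {M. w = p * real M + 1}). (- 1) ^ k / fact k * z k * a ^ k = 0"
        using z0 by simp
    qed auto
    then show ?thesis by (simp only: z_def)
  qed
  have sums: "(\<lambda>n. exp (- a * of_real (real (Suc n) powr p)) / of_real (real (Suc n) powr w)) sums theta p w a"
    if "Re a > 0" for a
  proof -
    have "damp p (of_real w) a 0 (real (Suc n)) = exp (- a * of_real (real (Suc n) powr p)) / of_real (real (Suc n) powr w)" for n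
      by (subst damp0_eq) (simp_all add: powr_minus divide_inverse mult.commute del: of_nat_Suc)
    with theta_sums_deriv(1)[OF p that, of w] show ?thesis by simp
  qed
  \<comment> \<open>the lower bound on \<open>N\<close> places the last exponent where \<open>gap_bounded\<close> applies\<close>
  have vN: "w - real N * p < 0"
  proof -
    have "(s\<^sub>0 + 3 / 2) * p < real N * p" using assms(6) p by (intro mult_strict_right_mono)
    also have "(s\<^sub>0 + 3 / 2) * p = w - 1 + 3 / 2 * p" using p assms(4) by (simp add: distrib_right)
    finally show ?thesis using assms(1) by linarith
  qed
  have bigo: "R \<in> O[at 0 within {a. \<bar>Arg a\<bar> \<le> pi / 2 - \<delta>}](\<lambda>a. a powr (of_nat N - 1 / 2))"
    if \<delta>: "0 < \<delta>" "\<delta> < pi / 2" for \<delta>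
  proof -
    define c where "c = sin \<delta>"
    have c: "c > 0" unfolding c_def using \<delta> by (intro sin_gt_zero) auto
    obtain B where B: "\<And>a. Re a > 0 \<Longrightarrow> c * norm a \<le> Re a \<Longrightarrow> norm (gap p (w - real N * p) a) \<le> B"
      using gap_bounded[OF p vN c] by blast
    have "\<exists>C\<ge>0. \<forall>a. Re a > 0 \<longrightarrow> c * norm a \<le> Re a \<longrightarrow>
        norm (gap p (w - real 0 * p) a - (\<Sum>i<N. (- 1) ^ i / fact i * z (0 + i) * a ^ i)) \<le> C * norm a ^ N"
    proof (rule cone_taylor[where g = "\<lambda>k. gap p (w - real k * p)"])
      show "(gap p (w - real k * p) has_field_derivative - gap p (w - real (Suc k) * p) a) (at a)" if "Re a > 0" for k a
        using gap_deriv[OF p that, of "w - real k * p"] by (simp add: algebra_simps)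
      show "((\<lambda>x. gap p (w - real k * p) (of_real x)) \<longlongrightarrow> z k) (at_right 0)" for k
        unfolding z_def by (rule gap_tendsto_zeta[OF p])
      show "norm (gap p (w - real (0 + N) * p) a) \<le> B" if "Re a > 0" "c * norm a \<le> Re a" for a
        using B[OF that] by simp
    qed (rule c)
    then obtain C where C: "C \<ge> 0" "\<And>a. Re a > 0 \<Longrightarrow> c * norm a \<le> Re a \<Longrightarrow> norm (R a) \<le> C * norm a ^ N"
      unfolding R_def by auto
    have "norm (R a) \<le> C * norm (a powr (of_nat N - 1 / 2))"
      if a: "\<bar>Arg a\<bar> \<le> pi / 2 - \<delta>" "a \<noteq> 0" "norm a < 1" for a
    proof -
      have "c = cos (pi / 2 - \<delta>)" by (simp add: c_def cos_diff)
      also have "\<dots> \<le> cos \<bar>Arg a\<bar>" using a \<delta> by (intro cos_monotone_0_pi_le) auto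
      also have "\<dots> = Re a / norm a" using a by (simp add: cos_Arg)
      finally have cone: "c * norm a \<le> Re a" using a by (simp add: field_simps)
      moreover have "c * norm a > 0" using a c by simp
      ultimately have "norm (R a) \<le> C * norm a ^ N" by (intro C(2)) auto
      also have "norm a ^ N = norm a powr real N" using a by (simp add: powr_realpow)
      also have "C * norm a powr real N \<le> C * norm a powr (real N - 1 / 2)"
        using a C(1) by (intro mult_left_mono powr_mono') auto
      also have "norm a powr (real N - 1 / 2) = norm (a powr (of_nat N - 1 / 2))"
        by (subst norm_powr_real_powr') auto
      finally show ?thesis .
    qed
    then show ?thesis
      by (intro bigoI[of _ C]) (auto simp: eventually_at intro!: exI[of _ 1])
  qed
  show ?thesis
  proof (rule exI[of _ R], intro conjI allI impI)
    fix a :: complex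
    assume "a \<noteq> 0 \<and> \<bar>Arg a\<bar> < pi / 2"
    then have "Re a > 0" using Arg_Re_pos by blast
    moreover have "theta p w a = J_main p a w
          + (\<Sum>k\<in>{..<N} - {M. w = p * real M + 1}. (- 1) ^ k / fact k * zeta (of_real (w - real k * p)) * a ^ k) + R a"
      unfolding omit R_def gap_def by simp
    ultimately show "(\<lambda>n. exp (- a * of_real (real (Suc n) powr p)) / of_real (real (Suc n) powr w)) sums
         (J_main p a w
          + (\<Sum>k\<in>{..<N} - {M. w = p * real M + 1}.
               (- 1) ^ k / fact k * zeta (of_real (w - real k * p)) * a ^ k)
          + R a)"
      using sums[of a] by (simp only:)
  qed (use bigo in auto)
qed

end
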